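(* For the representations $\rho^+=\rho^+_2$ and $\rho^-=\rho^-_2$ of $\mathfrak{sl}_2$ one has $$\dim H^1(\mathcal{U}_0(\mathfrak{sl}_2),\rho^{\pm},\ell^2)=1,$$ and $\dim H^1(\mathcal{U}_0(\mathfrak{sl}_2),\rho,D)=0$ for all other integrable unitary irreducible representations $\rho$ of $\mathfrak{sl}_2$ (with representation space $D$).
   Context: $\mathfrak{sl}_2$ is the complex Lie algebra with basis $B^+,B^-,M$, relations $[B^-,B^+]=M$, $[M,B^\pm]=\pm2B^\pm$, and involution $(B^-)^*=B^+$, $M^*=M$. $\mathcal{U}(\mathfrak{sl}_2)$ is its universal enveloping algebra with the induced involution, and $\mathcal{U}_0(\mathfrak{sl}_2)$ the non-unital subalgebra generated by $\mathfrak{sl}_2$ (the augmentation ideal). For a representation $\rho$ of $\mathcal{U}_0(\mathfrak{g})$ on a vector space $D$, a $\rho$-1-cocycle is a linear map $\eta:\mathcal{U}_0(\mathfrak{g})\to D$ with $\eta(uv)=\rho(u)\eta(v)$ for all $u,v\in\mathcal{U}_0(\mathfrak{g})$; it is trivial (a coboundary) if $\eta(u)=\rho(u)\omega$ for some $\omega\in D$. $Z^1$ and $B^1$ denote the spaces of all cocycles and of trivial cocycles, and $H^1(\mathcal{U}_0(\mathfrak{g}),\rho,D)=Z^1/B^1$. The integrable unitary irreducible representations of $\mathfrak{sl}_2$ (i.e. the $*$-representations on a pre-Hilbert space obtained by differentiating unitary irreducible representations of the corresponding simply connected Lie group) are, up to unitary equivalence, the following (each acting on the pre-Hilbert space spanned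 algebraically by the indicated orthonormal basis): (i) the one-dimensional trivial representation; (ii) $\rho^+_{m_0}$, $m_0>0$, on $\ell^2$ with orthonormal basis $(e_n)_{n\ge0}$: $B^+e_n=\sqrt{(n+1)(n+m_0)}\,e_{n+1}$, $Me_n=(2n+m_0)e_n$, $B^-e_n=\sqrt{n(n+m_0-1)}\,e_{n-1}$; (iii) $\rho^-_{m_0}$, $m_0>0$, on $\ell^2$: $B^-e_n=\sqrt{(n+1)(n+m_0)}\,e_{n+1}$, $Me_n=-(2n+m_0)e_n$, $B^+e_n=\sqrt{n(n+m_0-1)}\,e_{n-1}$; (iv) $\rho_{c,m_0}$, $m_0\in[0,2[$, $c<m_0(m_0-2)$, on $\ell^2(\mathbb{Z})$ with orthonormal basis $(e_n)_{n\in\mathbb{Z}}$: $B^+e_n=\frac12\sqrt{(m_0+2n+2)(m_0+2n)-c}\;e_{n+1}$, $Me_n=(2n+m_0)e_n$, $B^-e_n=\frac12\sqrt{(m_0+2n-2)(m_0+2n)-c}\;e_{n-1}$. In the claim "$\ell^2$" refers to the representation space of $\rho^\pm$, i.e. the algebraic span of $(e_n)_{n\ge 0}$. *)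

theory Defs
  imports Complex_Main "HOL-Library.Poly_Mapping"
begin

section \<open>The universal enveloping algebra of \<open>\<ss>\<ll>\<^sub>2\<close>\<close>

datatype sl2_basis = Bplus | Bminus | Mgen

text \<open>The involution of \<open>\<ss>\<ll>\<^sub>2\<close> permutes the basis.\<close>

fun basis_star :: "sl2_basis \<Rightarrow> sl2_basis" where
  "basis_star Bplus = Bminus"
| "basis_star Bminus = Bplus"
| "basis_star Mgen = Mgen"

text \<open>
  Words in the basis form the free monoid (written additively, as \<^class>\<open>monoid_add\<close> demands), so
  \<open>sl2_word \<Rightarrow>\<^sub>0 complex\<close> with its convolution product is the free unital associative complex algebra
  on the basis, that is, the tensor algebra of \<open>\<ss>\<ll>\<^sub>2\<close>.
\<close>

datatype sl2_word = Word (letters: "sl2_basis list")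

instantiation sl2_word :: monoid_add
begin

definition "0 = Word []"
definition "v + w = Word (letters v @ letters w)"

instance
  by standard (simp_all add: zero_sl2_word_def plus_sl2_word_def)

end

type_synonym tensor_sl2 = "sl2_word \<Rightarrow>\<^sub>0 complex"

definition tgen :: "sl2_basis \<Rightarrow> tensor_sl2" where
  "tgen X = Poly_Mapping.single (Word [X]) 1"

definition tscalar :: "complex \<Rightarrow> tensor_sl2" where
  "tscalar c = Poly_Mapping.single 0 c"

text \<open>
  The elements \<open>x y - y x - [x, y]\<close> for basis elements \<open>x\<close>, \<open>y\<close>; by bilinearity and antisymmetry of
  the bracket these three span all of them.
\<close>

definition sl2_relations :: "tensor_sl2 set" where
  "sl2_relations =
    {tgen Bminus * tgen Bplus - tgen Bplus * tgen Bminus - tgen Mgen,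
     tgen Mgen * tgen Bplus - tgen Bplus * tgen Mgen - tscalar 2 * tgen Bplus,
     tgen Mgen * tgen Bminus - tgen Bminus * tgen Mgen + tscalar 2 * tgen Bminus}"

inductive_set sl2_ideal :: "tensor_sl2 set" where
  zero: "0 \<in> sl2_ideal"
| gen: "r \<in> sl2_relations \<Longrightarrow> a * r * b \<in> sl2_ideal"
| add: "x \<in> sl2_ideal \<Longrightarrow> y \<in> sl2_ideal \<Longrightarrow> x + y \<in> sl2_ideal"

lemma sl2_ideal_mult_left: "x \<in> sl2_ideal \<Longrightarrow> a * x \<in> sl2_ideal"
proof (induction rule: sl2_ideal.induct)
  case (gen r b c)
  then show ?case using sl2_ideal.gen[of r "a * b" c] by (simp add: mult.assoc)
qed (auto simp: distrib_left intro: sl2_ideal.intros)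

lemma sl2_ideal_mult_right: "x \<in> sl2_ideal \<Longrightarrow> x * a \<in> sl2_ideal"
proof (induction rule: sl2_ideal.induct)
  case (gen r b c)
  then show ?case using sl2_ideal.gen[of r b "c * a"] by (simp add: mult.assoc)
qed (auto simp: distrib_right intro: sl2_ideal.intros)

lemma sl2_ideal_uminus: "x \<in> sl2_ideal \<Longrightarrow> - x \<in> sl2_ideal"
  using sl2_ideal_mult_left[of x "- 1"] by simp

lemma sl2_ideal_diff: "x \<in> sl2_ideal \<Longrightarrow> y \<in> sl2_ideal \<Longrightarrow> x - y \<in> sl2_ideal"
  using sl2_ideal.add[OF _ sl2_ideal_uminus, of x y] by simp

lemma sl2_cong_add:
  "x - x' \<in> sl2_ideal \<Longrightarrow> y - y' \<in> sl2_ideal \<Longrightarrow> (x + y) - (x' + y') \<in> sl2_ideal"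
  using sl2_ideal.add[of "x - x'" "y - y'"] by (simp add: algebra_simps)

lemma sl2_cong_mult:
  assumes "x - x' \<in> sl2_ideal" "y - y' \<in> sl2_ideal"
  shows "x * y - x' * y' \<in> sl2_ideal"
  using sl2_ideal.add[OF sl2_ideal_mult_right[OF assms(1), of y] sl2_ideal_mult_left[OF assms(2), of x']]
  by (simp add: algebra_simps)

quotient_type usl2 = "tensor_sl2" / "\<lambda>x y. x - y \<in> sl2_ideal"
proof (rule equivpI)
  show "reflp (\<lambda>x y. x - y \<in> sl2_ideal)"
    by (rule reflpI) (simp add: sl2_ideal.zero)
  show "symp (\<lambda>x y. x - y \<in> sl2_ideal)"
    by (rule sympI) (drule sl2_ideal_uminus, simp)
  show "transp (\<lambda>x y. x - y \<in> sl2_ideal)"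
  proof (rule transpI)
    fix x y z :: tensor_sl2
    assume "x - y \<in> sl2_ideal" "y - z \<in> sl2_ideal"
    from sl2_ideal.add[OF this] show "x - z \<in> sl2_ideal" by simp
  qed
qed

instantiation usl2 :: "{ring, monoid_mult}"
begin

lift_definition zero_usl2 :: usl2 is 0 .
lift_definition one_usl2 :: usl2 is 1 .
lift_definition plus_usl2 :: "usl2 \<Rightarrow> usl2 \<Rightarrow> usl2" is "(+)"
  by (rule sl2_cong_add)
lift_definition uminus_usl2 :: "usl2 \<Rightarrow> usl2" is uminus
  by (drule sl2_ideal_uminus) simp
lift_definition minus_usl2 :: "usl2 \<Rightarrow> usl2 \<Rightarrow> usl2" is "(-)"
  by (drule (1) sl2_ideal_diff) (simp add: algebra_simps)
lift_definition times_usl2 :: "usl2 \<Rightarrow> usl2 \<Rightarrow> usl2" is "(*)"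
  by (rule sl2_cong_mult)

instance
  by standard (transfer; simp add: sl2_ideal.zero algebra_simps)+

end

lift_definition uscale :: "complex \<Rightarrow> usl2 \<Rightarrow> usl2" is "\<lambda>c x. tscalar c * x"
  by (drule sl2_ideal_mult_left) (simp add: algebra_simps)

lift_definition ugen :: "sl2_basis \<Rightarrow> usl2" is tgen .

text \<open>The non-unital subalgebra generated by \<open>\<ss>\<ll>\<^sub>2\<close>.\<close>

inductive_set U0 :: "usl2 set" where
  gen: "ugen X \<in> U0"
| scale: "u \<in> U0 \<Longrightarrow> uscale c u \<in> U0"
| add: "u \<in> U0 \<Longrightarrow> v \<in> U0 \<Longrightarrow> u + v \<in> U0"
| mult: "u \<in> U0 \<Longrightarrow> v \<in> U0 \<Longrightarrow> u * v \<in> U0"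


section \<open>Representations and first cohomology\<close>

text \<open>Only the restriction of \<open>\<rho>\<close> to \<^const>\<open>U0\<close> is relevant, here and below.\<close>

locale U0_representation = vector_space scale
  for scale :: "complex \<Rightarrow> 'd::ab_group_add \<Rightarrow> 'd" +
  fixes \<rho> :: "usl2 \<Rightarrow> 'd \<Rightarrow> 'd"
  assumes rep_linear: "u \<in> U0 \<Longrightarrow> Vector_Spaces.linear scale scale (\<rho> u)"
    and rep_add: "u \<in> U0 \<Longrightarrow> v \<in> U0 \<Longrightarrow> \<rho> (u + v) x = \<rho> u x + \<rho> v x"
    and rep_scale: "u \<in> U0 \<Longrightarrow> \<rho> (uscale c u) x = scale c (\<rho> u x)"
    and rep_mult: "u \<in> U0 \<Longrightarrow> v \<in> U0 \<Longrightarrow> \<rho> (u * v) x = \<rho> u (\<rho> v x)"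

text \<open>
  A map defined on \<^const>\<open>U0\<close> is represented by its extension by zero to the whole enveloping algebra.
\<close>

definition Z1 :: "(complex \<Rightarrow> 'd::ab_group_add \<Rightarrow> 'd) \<Rightarrow> (usl2 \<Rightarrow> 'd \<Rightarrow> 'd) \<Rightarrow> (usl2 \<Rightarrow> 'd) set" where
  "Z1 scale \<rho> = {\<eta>.
     (\<forall>u. u \<notin> U0 \<longrightarrow> \<eta> u = 0) \<and>
     (\<forall>u\<in>U0. \<forall>v\<in>U0. \<eta> (u + v) = \<eta> u + \<eta> v) \<and>
     (\<forall>c. \<forall>u\<in>U0. \<eta> (uscale c u) = scale c (\<eta> u)) \<and>
     (\<forall>u\<in>U0. \<forall>v\<in>U0. \<eta> (u * v) = \<rho> u (\<eta> v))}"

definition B1 :: "(usl2 \<Rightarrow> 'd::ab_group_add \<Rightarrow> 'd) \<Rightarrow> (usl2 \<Rightarrow> 'd) set" where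
  "B1 \<rho> = {\<eta>. \<exists>\<omega>. \<eta> = (\<lambda>u. if u \<in> U0 then \<rho> u \<omega> else 0)}"

definition H1 :: "(complex \<Rightarrow> 'd::ab_group_add \<Rightarrow> 'd) \<Rightarrow> (usl2 \<Rightarrow> 'd \<Rightarrow> 'd) \<Rightarrow> (usl2 \<Rightarrow> 'd) set set" where
  "H1 scale \<rho> =
     Z1 scale \<rho> // {(\<eta>, \<zeta>). \<eta> \<in> Z1 scale \<rho> \<and> \<zeta> \<in> Z1 scale \<rho> \<and> (\<lambda>u. \<eta> u - \<zeta> u) \<in> B1 \<rho>}"

text \<open>
  \<open>H1\<close> has dimension \<open>n\<close>: there are cocycles \<open>b 0, \<dots>, b (n - 1)\<close> whose classes form a basis of
  the quotient space, i.e. every class \<open>X\<close> is the class of \<open>\<Sum>i<n. c i \<cdot> b i\<close> for exactly one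
  coefficient vector \<open>c\<close>. (Unlike an equation for \<^const>\<open>vector_space.dim\<close>, which is \<open>0\<close> in infinite
  dimension, this entails finite-dimensionality.)
\<close>

definition H1_has_dim ::
  "(complex \<Rightarrow> 'd::ab_group_add \<Rightarrow> 'd) \<Rightarrow> (usl2 \<Rightarrow> 'd \<Rightarrow> 'd) \<Rightarrow> nat \<Rightarrow> bool" where
  "H1_has_dim scale \<rho> n \<longleftrightarrow>
     (\<exists>b :: nat \<Rightarrow> usl2 \<Rightarrow> 'd.
        (\<forall>i<n. b i \<in> Z1 scale \<rho>) \<and>
        (\<forall>X\<in>H1 scale \<rho>. \<exists>!c :: nat \<Rightarrow> complex.
           (\<forall>i\<ge>n. c i = 0) \<and> (\<lambda>u. \<Sum>i<n. scale (c i) (b i u)) \<in> X))"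


section \<open>Unitary representations\<close>

locale pre_hilbert = vector_space scale
  for scale :: "complex \<Rightarrow> 'd::ab_group_add \<Rightarrow> 'd" +
  fixes ip :: "'d \<Rightarrow> 'd \<Rightarrow> complex"
  assumes ip_add_right: "ip x (y + z) = ip x y + ip x z"
    and ip_scale_right: "ip x (scale c y) = c * ip x y"
    and ip_commute: "ip y x = cnj (ip x y)"
    and ip_pos: "x \<noteq> 0 \<Longrightarrow> Re (ip x x) > 0"

text \<open>
  As \<^const>\<open>U0\<close> is generated by the basis of \<open>\<ss>\<ll>\<^sub>2\<close> and its involution is induced by
  \<^const>\<open>basis_star\<close>, it suffices to state the adjointness condition on the basis.
\<close>

locale U0_star_representation = pre_hilbert scale ip + U0_representation scale \<rho>
  for scale :: "complex \<Rightarrow> 'd::ab_group_add \<Rightarrow> 'd" and ip \<rho> +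
  assumes rep_star: "ip (\<rho> (ugen X) x) y = ip x (\<rho> (ugen (basis_star X)) y)"

definition unitarily_equivalent ::
  "(complex \<Rightarrow> 'd::ab_group_add \<Rightarrow> 'd) \<Rightarrow> ('d \<Rightarrow> 'd \<Rightarrow> complex) \<Rightarrow> (usl2 \<Rightarrow> 'd \<Rightarrow> 'd) \<Rightarrow>
   (complex \<Rightarrow> 'e::ab_group_add \<Rightarrow> 'e) \<Rightarrow> ('e \<Rightarrow> 'e \<Rightarrow> complex) \<Rightarrow> (usl2 \<Rightarrow> 'e \<Rightarrow> 'e) \<Rightarrow> bool" where
  "unitarily_equivalent scale ip \<rho> scale' ip' \<rho>' \<longleftrightarrow>
     (\<exists>T. bij T \<and> Vector_Spaces.linear scale scale' T \<and>
          (\<forall>x y. ip' (T x) (T y) = ip x y) \<and>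
          (\<forall>u\<in>U0. \<forall>x. T (\<rho> u x) = \<rho>' u (T x)))"

text \<open>
  The extension to the enveloping algebra of operators \<open>f X\<close> assigned to the basis elements \<open>X\<close>.
  The choice of a representative is immaterial if the \<open>f X\<close> satisfy the commutation relations.
\<close>

definition word_act :: "(sl2_basis \<Rightarrow> 'd \<Rightarrow> 'd) \<Rightarrow> sl2_word \<Rightarrow> 'd \<Rightarrow> 'd" where
  "word_act f w = foldr f (letters w)"

definition tensor_act ::
  "(complex \<Rightarrow> 'd::ab_group_add \<Rightarrow> 'd) \<Rightarrow> (sl2_basis \<Rightarrow> 'd \<Rightarrow> 'd) \<Rightarrow> tensor_sl2 \<Rightarrow> 'd \<Rightarrow> 'd" where
  "tensor_act scale f p x = (\<Sum>w\<in>Poly_Mapping.keys p. scale (Poly_Mapping.lookup p w) (word_act f w x))"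

definition U_act ::
  "(complex \<Rightarrow> 'd::ab_group_add \<Rightarrow> 'd) \<Rightarrow> (sl2_basis \<Rightarrow> 'd \<Rightarrow> 'd) \<Rightarrow> usl2 \<Rightarrow> 'd \<Rightarrow> 'd" where
  "U_act scale f u = tensor_act scale f (rep_usl2 u)"

locale sl2_operators = vector_space scale
  for scale :: "complex \<Rightarrow> 'd::ab_group_add \<Rightarrow> 'd" +
  fixes f :: "sl2_basis \<Rightarrow> 'd \<Rightarrow> 'd"
  assumes lin: "Vector_Spaces.linear scale scale (f X)"
    and rel_M: "f Bminus (f Bplus x) - f Bplus (f Bminus x) = f Mgen x"
    and rel_plus: "f Mgen (f Bplus x) - f Bplus (f Mgen x) = scale 2 (f Bplus x)"
    and rel_minus: "f Mgen (f Bminus x) - f Bminus (f Mgen x) = - scale 2 (f Bminus x)"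
begin

lemma word_act_linear: "Vector_Spaces.linear scale scale (word_act f w)"
proof -
  have "Vector_Spaces.linear scale scale (foldr f xs)" for xs
  proof (induction xs)
    case Nil
    show ?case using linear_id by (simp add: id_def)
  next
    case (Cons a xs)
    then show ?case using Vector_Spaces.linear_compose[OF Cons lin[of a]] by (simp add: comp_def)
  qed
  then show ?thesis by (simp add: word_act_def)
qed

lemma word_act_plus: "word_act f (v + w) x = word_act f v (word_act f w x)"
  by (simp add: word_act_def plus_sl2_word_def)

lemma tensor_act_superset:
  assumes "finite A" "Poly_Mapping.keys p \<subseteq> A"
  shows "tensor_act scale f p x = (\<Sum>w\<in>A. scale (Poly_Mapping.lookup p w) (word_act f w x))"
  unfolding tensor_act_def
  by (rule sum.mono_neutral_left) (use assms in \<open>auto simp: in_keys_iff\<close>)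

lemma tensor_act_add: "tensor_act scale f (p + q) x = tensor_act scale f p x + tensor_act scale f q x"
proof -
  let ?A = "Poly_Mapping.keys p \<union> Poly_Mapping.keys q"
  have "Poly_Mapping.keys (p + q) \<subseteq> ?A" by (rule Poly_Mapping.keys_add)
  then show ?thesis
    by (simp add: tensor_act_superset[of ?A] lookup_add scale_left_distrib sum.distrib)
qed

lemma tensor_act_single: "tensor_act scale f (Poly_Mapping.single w c) x = scale c (word_act f w x)"
  by (cases "c = 0") (simp_all add: tensor_act_def)

lemma tensor_act_zero [simp]: "tensor_act scale f 0 x = 0"
  by (simp add: tensor_act_def)

lemma tensor_act_uminus: "tensor_act scale f (- p) x = - tensor_act scale f p x"
  using tensor_act_add[of p "- p" x] by (simp add: minus_unique)

lemma tensor_act_diff: "tensor_act scale f (p - q) x = tensor_act scale f p x - tensor_act scale f q x"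
  using tensor_act_add[of p "- q" x] by (simp add: tensor_act_uminus)

lemma tensor_act_linear: "Vector_Spaces.linear scale scale (tensor_act scale f p)"
proof -
  interpret p: vector_space_pair scale scale ..
  show ?thesis
    unfolding tensor_act_def [abs_def]
    by (intro p.linear_compose_sum ballI p.linear_compose_scale_right word_act_linear)
qed

lemma tensor_induct [case_names zero add single]:
  assumes "P 0" "\<And>p q. P p \<Longrightarrow> P q \<Longrightarrow> P (p + q)" "\<And>w c. P (Poly_Mapping.single w c)"
  shows "P (p :: tensor_sl2)"
proof -
  have "P (\<Sum>w\<in>A. Poly_Mapping.single w (Poly_Mapping.lookup p w))" if "finite A" for A
    using that by induction (use assms in auto)
  moreover have "(\<Sum>w\<in>Poly_Mapping.keys p. Poly_Mapping.single w (Poly_Mapping.lookup p w)) = p"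
    by (rule poly_mapping_eqI)
       (simp add: lookup_sum lookup_single when_def in_keys_iff)
  ultimately show ?thesis by (metis finite_keys)
qed

lemma tensor_act_mult: "tensor_act scale f (p * q) x = tensor_act scale f p (tensor_act scale f q x)"
proof (induction p rule: tensor_induct)
  case zero
  then show ?case by simp
next
  case (add p p')
  then show ?case by (simp add: distrib_right tensor_act_add)
next
  case (single v c)
  interpret w: Vector_Spaces.linear scale scale "word_act f v" by (rule word_act_linear)
  show ?case
  proof (induction q rule: tensor_induct)
    case zero
    then show ?case by (simp add: tensor_act_single w.zero)
  next
    case (add q q')
    then show ?case
      by (simp add: distrib_left tensor_act_add tensor_act_single w.add scale_right_distrib)
  next
    case (single w d)
    then show ?case by (simp add: mult_single tensor_act_single word_act_plus w.scale)
  qed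
qed

lemma tensor_act_tgen: "tensor_act scale f (tgen X) x = f X x"
  by (simp add: tgen_def tensor_act_single word_act_def)

lemma tensor_act_tscalar: "tensor_act scale f (tscalar c) x = scale c x"
  by (simp add: tscalar_def tensor_act_single word_act_def zero_sl2_word_def)

lemma tensor_act_ideal: "p \<in> sl2_ideal \<Longrightarrow> tensor_act scale f p x = 0"
proof (induction arbitrary: x rule: sl2_ideal.induct)
  case zero
  then show ?case by simp
next
  case (gen r a b)
  interpret a: Vector_Spaces.linear scale scale "tensor_act scale f a" by (rule tensor_act_linear)
  have "tensor_act scale f r y = 0" for y
    using gen rel_M[of y] rel_plus[of y] rel_minus[of y]
    by (auto simp: sl2_relations_def tensor_act_diff tensor_act_add tensor_act_mult
        tensor_act_tgen tensor_act_tscalar)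
  then show ?case by (simp add: tensor_act_mult a.zero)
next
  case (add p q)
  then show ?case by (simp add: tensor_act_add)
qed

lemma U_act_abs: "U_act scale f (abs_usl2 p) x = tensor_act scale f p x"
proof -
  have "rep_usl2 (abs_usl2 p) - p \<in> sl2_ideal"
    by (simp add: usl2.abs_eq_iff[symmetric] Quotient3_abs_rep[OF Quotient3_usl2])
  then show ?thesis
    using tensor_act_ideal[of "rep_usl2 (abs_usl2 p) - p" x] by (simp add: U_act_def tensor_act_diff)
qed

lemma U_act_ugen: "U_act scale f (ugen X) x = f X x"
  by (simp add: ugen.abs_eq U_act_abs tensor_act_tgen)

lemma U_act_one: "U_act scale f 1 x = x"
  using tensor_act_tscalar[of 1] by (simp add: one_usl2.abs_eq U_act_abs tscalar_def)

lemma U_act_add: "U_act scale f (u + v) x = U_act scale f u x + U_act scale f v x"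
  by (induct u; induct v) (simp add: plus_usl2.abs_eq U_act_abs tensor_act_add)

lemma U_act_mult: "U_act scale f (u * v) x = U_act scale f u (U_act scale f v x)"
  by (induct u; induct v) (simp add: times_usl2.abs_eq U_act_abs tensor_act_mult)

lemma U_act_scale: "U_act scale f (uscale c u) x = scale c (U_act scale f u x)"
  by (induct u) (simp add: uscale.abs_eq U_act_abs tensor_act_mult tensor_act_tscalar)

lemma U_act_linear: "Vector_Spaces.linear scale scale (U_act scale f u)"
  by (simp add: U_act_def tensor_act_linear)

sublocale U0_representation scale "U_act scale f"
  by (intro U0_representation.intro U0_representation_axioms.intro vector_space_axioms)
     (simp_all add: U_act_linear U_act_add U_act_scale U_act_mult)

end


section \<open>The integrable unitary irreducible representations\<close>

text \<open>
  The pre-Hilbert space with orthonormal basis \<open>e i = single i 1\<close>, for \<open>i\<close> in the index type.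
\<close>

definition fs_scale :: "complex \<Rightarrow> ('i \<Rightarrow>\<^sub>0 complex) \<Rightarrow> ('i \<Rightarrow>\<^sub>0 complex)" where
  "fs_scale c x = Poly_Mapping.map ((*) c) x"

definition fs_ip :: "('i \<Rightarrow>\<^sub>0 complex) \<Rightarrow> ('i \<Rightarrow>\<^sub>0 complex) \<Rightarrow> complex" where
  "fs_ip x y = (\<Sum>i\<in>Poly_Mapping.keys x. cnj (Poly_Mapping.lookup x i) * Poly_Mapping.lookup y i)"

text \<open>The linear operator with \<open>e i \<mapsto> a i \<cdot> e (s i)\<close>.\<close>

definition wshift :: "('i \<Rightarrow> 'i) \<Rightarrow> ('i \<Rightarrow> complex) \<Rightarrow> ('i \<Rightarrow>\<^sub>0 complex) \<Rightarrow> ('i \<Rightarrow>\<^sub>0 complex)" where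
  "wshift s a x = (\<Sum>i\<in>Poly_Mapping.keys x. Poly_Mapping.single (s i) (a i * Poly_Mapping.lookup x i))"

text \<open>For \<open>n = 0\<close> the coefficient of the lowering operator vanishes, so \<open>e (0 - 1) = e 0\<close> does no harm.\<close>

fun plus_ops :: "real \<Rightarrow> sl2_basis \<Rightarrow> (nat \<Rightarrow>\<^sub>0 complex) \<Rightarrow> (nat \<Rightarrow>\<^sub>0 complex)" where
  "plus_ops m\<^sub>0 Bplus = wshift (\<lambda>n. n + 1) (\<lambda>n. complex_of_real (sqrt ((real n + 1) * (real n + m\<^sub>0))))"
| "plus_ops m\<^sub>0 Mgen = wshift (\<lambda>n. n) (\<lambda>n. complex_of_real (2 * real n + m\<^sub>0))"
| "plus_ops m\<^sub>0 Bminus = wshift (\<lambda>n. n - 1) (\<lambda>n. complex_of_real (sqrt (real n * (real n + m\<^sub>0 - 1))))"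

fun minus_ops :: "real \<Rightarrow> sl2_basis \<Rightarrow> (nat \<Rightarrow>\<^sub>0 complex) \<Rightarrow> (nat \<Rightarrow>\<^sub>0 complex)" where
  "minus_ops m\<^sub>0 Bminus = wshift (\<lambda>n. n + 1) (\<lambda>n. complex_of_real (sqrt ((real n + 1) * (real n + m\<^sub>0))))"
| "minus_ops m\<^sub>0 Mgen = wshift (\<lambda>n. n) (\<lambda>n. complex_of_real (- (2 * real n + m\<^sub>0)))"
| "minus_ops m\<^sub>0 Bplus = wshift (\<lambda>n. n - 1) (\<lambda>n. complex_of_real (sqrt (real n * (real n + m\<^sub>0 - 1))))"

fun bilateral_ops :: "real \<Rightarrow> real \<Rightarrow> sl2_basis \<Rightarrow> (int \<Rightarrow>\<^sub>0 complex) \<Rightarrow> (int \<Rightarrow>\<^sub>0 complex)" where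
  "bilateral_ops c m\<^sub>0 Bplus = wshift (\<lambda>n. n + 1)
     (\<lambda>n. complex_of_real (1 / 2 * sqrt ((m\<^sub>0 + 2 * real_of_int n + 2) * (m\<^sub>0 + 2 * real_of_int n) - c)))"
| "bilateral_ops c m\<^sub>0 Mgen = wshift (\<lambda>n. n) (\<lambda>n. complex_of_real (2 * real_of_int n + m\<^sub>0))"
| "bilateral_ops c m\<^sub>0 Bminus = wshift (\<lambda>n. n - 1)
     (\<lambda>n. complex_of_real (1 / 2 * sqrt ((m\<^sub>0 + 2 * real_of_int n - 2) * (m\<^sub>0 + 2 * real_of_int n) - c)))"

definition rho_plus :: "real \<Rightarrow> usl2 \<Rightarrow> (nat \<Rightarrow>\<^sub>0 complex) \<Rightarrow> (nat \<Rightarrow>\<^sub>0 complex)" where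
  "rho_plus m\<^sub>0 = U_act fs_scale (plus_ops m\<^sub>0)"

definition rho_minus :: "real \<Rightarrow> usl2 \<Rightarrow> (nat \<Rightarrow>\<^sub>0 complex) \<Rightarrow> (nat \<Rightarrow>\<^sub>0 complex)" where
  "rho_minus m\<^sub>0 = U_act fs_scale (minus_ops m\<^sub>0)"

definition rho_bilateral :: "real \<Rightarrow> real \<Rightarrow> usl2 \<Rightarrow> (int \<Rightarrow>\<^sub>0 complex) \<Rightarrow> (int \<Rightarrow>\<^sub>0 complex)" where
  "rho_bilateral c m\<^sub>0 = U_act fs_scale (bilateral_ops c m\<^sub>0)"

definition rho_trivial :: "usl2 \<Rightarrow> complex \<Rightarrow> complex" where
  "rho_trivial = U_act (*) (\<lambda>X x. 0)"

definition complex_ip :: "complex \<Rightarrow> complex \<Rightarrow> complex" where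
  "complex_ip x y = cnj x * y"

text \<open>
  Integrable means: obtained by differentiating a unitary irreducible representation of the simply
  connected Lie group of the real form of \<open>\<ss>\<ll>\<^sub>2\<close> given by the involution, restricted to the algebraic
  span of the weight vectors. These representations are specified here through their known
  classification up to unitary equivalence.
\<close>

definition integrable_unitary_irrep ::
  "(complex \<Rightarrow> 'd::ab_group_add \<Rightarrow> 'd) \<Rightarrow> ('d \<Rightarrow> 'd \<Rightarrow> complex) \<Rightarrow> (usl2 \<Rightarrow> 'd \<Rightarrow> 'd) \<Rightarrow> bool" where
  "integrable_unitary_irrep scale ip \<rho> \<longleftrightarrow>
     U0_star_representation scale ip \<rho> \<and>
     (unitarily_equivalent scale ip \<rho> (*) complex_ip rho_trivial \<or>
      (\<exists>m\<^sub>0>0. unitarily_equivalent scale ip \<rho> fs_scale fs_ip (rho_plus m\<^sub>0)) \<or>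
      (\<exists>m\<^sub>0>0. unitarily_equivalent scale ip \<rho> fs_scale fs_ip (rho_minus m\<^sub>0)) \<or>
      (\<exists>m\<^sub>0 c. 0 \<le> m\<^sub>0 \<and> m\<^sub>0 < 2 \<and> c < m\<^sub>0 * (m\<^sub>0 - 2) \<and>
         unitarily_equivalent scale ip \<rho> fs_scale fs_ip (rho_bilateral c m\<^sub>0)))"

text \<open>The listed operators do define \<open>*\<close>-representations of \<^const>\<open>U0\<close> on pre-Hilbert spaces.\<close>

lemma lookup_fs_scale [simp]: "Poly_Mapping.lookup (fs_scale c x) i = c * Poly_Mapping.lookup x i"
  by (simp add: fs_scale_def Poly_Mapping.map.rep_eq when_def)

lemma fs_ip_superset:
  assumes "finite A" "Poly_Mapping.keys x \<subseteq> A"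
  shows "fs_ip x y = (\<Sum>i\<in>A. cnj (Poly_Mapping.lookup x i) * Poly_Mapping.lookup y i)"
  unfolding fs_ip_def by (rule sum.mono_neutral_left) (use assms in \<open>auto simp: in_keys_iff\<close>)

lemma wshift_superset:
  assumes "finite A" "Poly_Mapping.keys x \<subseteq> A"
  shows "wshift s a x = (\<Sum>i\<in>A. Poly_Mapping.single (s i) (a i * Poly_Mapping.lookup x i))"
  unfolding wshift_def by (rule sum.mono_neutral_left) (use assms in \<open>auto simp: in_keys_iff\<close>)

lemma vector_space_fs: "vector_space fs_scale"
  by standard (rule poly_mapping_eqI; simp add: lookup_add algebra_simps)+

lemma pre_hilbert_fs: "pre_hilbert fs_scale fs_ip"
proof (intro pre_hilbert.intro vector_space_fs pre_hilbert_axioms.intro)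
  fix x y z :: "'a \<Rightarrow>\<^sub>0 complex" and c
  show "fs_ip x (y + z) = fs_ip x y + fs_ip x z"
    by (simp add: fs_ip_def lookup_add distrib_left sum.distrib)
  show "fs_ip x (fs_scale c y) = c * fs_ip x y"
    by (simp add: fs_ip_def sum_distrib_left mult_ac)
  let ?A = "Poly_Mapping.keys x \<union> Poly_Mapping.keys y"
  show "fs_ip y x = cnj (fs_ip x y)"
    by (simp add: fs_ip_superset[of ?A] mult.commute)
  assume "x \<noteq> 0"
  then have ne: "Poly_Mapping.keys x \<noteq> {}" by simp
  have "Re (fs_ip x x) = (\<Sum>i\<in>Poly_Mapping.keys x. (cmod (Poly_Mapping.lookup x i))\<^sup>2)"
    by (simp add: fs_ip_def cmod_power2) (simp add: power2_eq_square)
  also have "\<dots> > 0"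
    by (rule sum_pos) (use ne in \<open>auto simp: in_keys_iff\<close>)
  finally show "Re (fs_ip x x) > 0" .
qed

lemma wshift_add: "wshift s a (x + y) = wshift s a x + wshift s a y"
proof -
  let ?A = "Poly_Mapping.keys x \<union> Poly_Mapping.keys y"
  have "Poly_Mapping.keys (x + y) \<subseteq> ?A" by (rule Poly_Mapping.keys_add)
  then show ?thesis
    by (simp add: wshift_superset[of ?A] lookup_add distrib_left sum.distrib single_add)
qed

lemma wshift_scale: "wshift s a (fs_scale c x) = fs_scale c (wshift s a x)"
proof -
  have "Poly_Mapping.keys (fs_scale c x) \<subseteq> Poly_Mapping.keys x"
    by (auto simp: in_keys_iff)
  then show ?thesis
    by (intro poly_mapping_eqI)
       (simp add: wshift_superset[of "Poly_Mapping.keys x"] lookup_sum sum_distrib_left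
          lookup_single when_def if_distrib mult_ac cong: if_cong)
qed

lemma wshift_single: "wshift s a (Poly_Mapping.single i c) = Poly_Mapping.single (s i) (a i * c)"
  by (cases "c = 0") (simp_all add: wshift_def)

lemma linear_wshift: "Vector_Spaces.linear fs_scale fs_scale (wshift s a)"
  using vector_space_fs
  by (simp add: Vector_Spaces.linear_def module_hom_def module_hom_axioms_def
      vector_space_def module_def wshift_add wshift_scale)

lemma fs_induct [case_names zero add single]:
  assumes "P 0" "\<And>p q. P p \<Longrightarrow> P q \<Longrightarrow> P (p + q)" "\<And>i c. P (Poly_Mapping.single i c)"
  shows "P (x :: 'i \<Rightarrow>\<^sub>0 complex)"
proof -
  have "P (\<Sum>w\<in>A. Poly_Mapping.single w (Poly_Mapping.lookup x w))" if "finite A" for A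
    using that by induction (use assms in auto)
  moreover have "(\<Sum>w\<in>Poly_Mapping.keys x. Poly_Mapping.single w (Poly_Mapping.lookup x w)) = x"
    by (rule poly_mapping_eqI) (simp add: lookup_sum lookup_single when_def in_keys_iff)
  ultimately show ?thesis by (metis finite_keys)
qed

lemma wshift_zero [simp]: "wshift s a 0 = 0"
  by (simp add: wshift_def)

lemma fs_scale_single: "fs_scale c (Poly_Mapping.single i d) = Poly_Mapping.single i (c * d)"
  by (rule poly_mapping_eqI) (simp add: lookup_single when_def)

lemma fs_ip_zero [simp]: "fs_ip 0 y = 0" "fs_ip x 0 = 0"
  by (simp_all add: fs_ip_def)

lemma fs_ip_add_left: "fs_ip (x + y) z = fs_ip x z + fs_ip y z"
proof -
  let ?A = "Poly_Mapping.keys x \<union> Poly_Mapping.keys y"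
  have "Poly_Mapping.keys (x + y) \<subseteq> ?A" by (rule Poly_Mapping.keys_add)
  then show ?thesis
    by (simp add: fs_ip_superset[of ?A] lookup_add distrib_right sum.distrib)
qed

lemma fs_ip_add_right: "fs_ip x (y + z) = fs_ip x y + fs_ip x z"
  by (simp add: fs_ip_def lookup_add distrib_left sum.distrib)

lemma fs_ip_single:
  "fs_ip (Poly_Mapping.single i c) (Poly_Mapping.single j d) = (if i = j then cnj c * d else 0)"
  by (cases "c = 0") (simp_all add: fs_ip_def lookup_single when_def)

lemma wshift_adjoint:
  assumes "\<And>i j c d. fs_ip (Poly_Mapping.single (s i) (a i * c)) (Poly_Mapping.single j d) =
                      fs_ip (Poly_Mapping.single i c) (Poly_Mapping.single (t j) (b j * d))"
  shows "fs_ip (wshift s a x) y = fs_ip x (wshift t b y)"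
proof (induction x rule: fs_induct)
  case (single i c)
  show ?case
    by (induction y rule: fs_induct) (simp_all add: wshift_add fs_ip_add_right wshift_single assms)
qed (simp_all add: wshift_add fs_ip_add_left)

lemma single_diff': "Poly_Mapping.single i (c::complex) - Poly_Mapping.single i d = Poly_Mapping.single i (c - d)"
  by (rule poly_mapping_eqI) (simp add: lookup_minus lookup_single when_def)

lemma wshift_wshift: "wshift s a (wshift t b x) = wshift (\<lambda>i. s (t i)) (\<lambda>i. a (t i) * b i) x"
  by (induction x rule: fs_induct) (simp_all add: wshift_add wshift_single mult.assoc)

lemma fs_scale_wshift: "fs_scale c (wshift s a x) = wshift s (\<lambda>i. c * a i) x"
proof -
  interpret vector_space fs_scale by (rule vector_space_fs)
  show ?thesis
    by (induction x rule: fs_induct)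
       (simp_all add: wshift_add wshift_single fs_scale_single scale_right_distrib mult.assoc)
qed

lemma wshift_diff:
  assumes "\<And>i. Poly_Mapping.single (s i) (a i) - Poly_Mapping.single (t i) (b i) =
                Poly_Mapping.single (r i) (d i)"
  shows "wshift s a x - wshift t b x = wshift r d x"
proof (induction x rule: fs_induct)
  case (add p q)
  have "wshift s a (p + q) - wshift t b (p + q) =
          (wshift s a p - wshift t b p) + (wshift s a q - wshift t b q)"
    by (simp add: wshift_add)
  then show ?case by (simp add: add wshift_add)
next
  case (single i c)
  have "fs_scale c (Poly_Mapping.single (s i) (a i) - Poly_Mapping.single (t i) (b i)) =
        fs_scale c (Poly_Mapping.single (r i) (d i))"
    by (simp add: assms)
  then show ?case
    by (simp add: module.scale_right_diff_distrib[OF vector_space_fs[unfolded module_iff_vector_space[symmetric]]]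
        wshift_single fs_scale_single mult.commute[of _ c])
qed simp

lemma of_real_sqrt_sqrt:
  "0 \<le> r \<Longrightarrow> complex_of_real (sqrt r) * complex_of_real (sqrt r) = complex_of_real r"
  by (metis of_real_mult real_sqrt_mult_self abs_of_nonneg)

lemma fs_minus_scale: "- fs_scale c x = fs_scale (- c) x"
  by (rule poly_mapping_eqI) simp

lemma minus_fs_scale_wshift: "- fs_scale c (wshift s a x) = wshift s (\<lambda>i. - c * a i) x"
  by (rule trans[OF fs_minus_scale fs_scale_wshift])

lemma sl2_operators_plus:
  assumes "m\<^sub>0 > 0"
  shows "sl2_operators fs_scale (plus_ops m\<^sub>0)"
proof (intro sl2_operators.intro vector_space_fs sl2_operators_axioms.intro)
  show "Vector_Spaces.linear fs_scale fs_scale (plus_ops m\<^sub>0 X)" for X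
    by (cases X) (simp_all add: linear_wshift)
  have nonneg: "0 \<le> (real n + 1) * (real n + m\<^sub>0)" for n
    using assms by simp
  show "plus_ops m\<^sub>0 Bminus (plus_ops m\<^sub>0 Bplus x) - plus_ops m\<^sub>0 Bplus (plus_ops m\<^sub>0 Bminus x) =
          plus_ops m\<^sub>0 Mgen x" for x
    unfolding plus_ops.simps wshift_wshift
  proof (rule wshift_diff)
    fix n :: nat
    show "Poly_Mapping.single (n + 1 - 1)
            (complex_of_real (sqrt (real (n + 1) * (real (n + 1) + m\<^sub>0 - 1))) *
             complex_of_real (sqrt ((real n + 1) * (real n + m\<^sub>0)))) -
          Poly_Mapping.single (n - 1 + 1)
            (complex_of_real (sqrt ((real (n - 1) + 1) * (real (n - 1) + m\<^sub>0))) *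
             complex_of_real (sqrt (real n * (real n + m\<^sub>0 - 1)))) =
          Poly_Mapping.single n (complex_of_real (2 * real n + m\<^sub>0))"
    proof (cases n)
      case 0
      then show ?thesis using assms by (simp add: of_real_sqrt_sqrt)
    next
      case (Suc k)
      then show ?thesis
        using nonneg[of k] nonneg[of n]
        by (simp add: single_diff' of_real_sqrt_sqrt add_ac del: of_real_mult) (simp add: algebra_simps)
    qed
  qed
  show "plus_ops m\<^sub>0 Mgen (plus_ops m\<^sub>0 Bplus x) - plus_ops m\<^sub>0 Bplus (plus_ops m\<^sub>0 Mgen x) =
          fs_scale 2 (plus_ops m\<^sub>0 Bplus x)" for x
    unfolding plus_ops.simps wshift_wshift fs_scale_wshift
    by (rule wshift_diff) (simp add: single_diff' algebra_simps)
  show "plus_ops m\<^sub>0 Mgen (plus_ops m\<^sub>0 Bminus x) - plus_ops m\<^sub>0 Bminus (plus_ops m\<^sub>0 Mgen x) =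
          - fs_scale 2 (plus_ops m\<^sub>0 Bminus x)" for x
    unfolding plus_ops.simps wshift_wshift minus_fs_scale_wshift
  proof (rule wshift_diff, goal_cases)
    case (1 n)
    show ?case by (cases n) (simp_all add: single_diff' algebra_simps)
  qed
qed

lemma sl2_operators_minus:
  assumes "m\<^sub>0 > 0"
  shows "sl2_operators fs_scale (minus_ops m\<^sub>0)"
proof (intro sl2_operators.intro vector_space_fs sl2_operators_axioms.intro)
  interpret p: sl2_operators fs_scale "plus_ops m\<^sub>0" by (rule sl2_operators_plus[OF assms])
  have eq: "minus_ops m\<^sub>0 Bplus = plus_ops m\<^sub>0 Bminus" "minus_ops m\<^sub>0 Bminus = plus_ops m\<^sub>0 Bplus"
    by simp_all
  have M: "minus_ops m\<^sub>0 Mgen x = - plus_ops m\<^sub>0 Mgen x" for x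
    using fs_minus_scale[of 1 "plus_ops m\<^sub>0 Mgen x"] by (simp add: fs_scale_wshift)
  have neg: "wshift s a (- x) = - wshift s a x" for s x and a :: "nat \<Rightarrow> complex"
    using wshift_scale[of s a "- 1" x] by (simp add: fs_minus_scale[symmetric])
  show "Vector_Spaces.linear fs_scale fs_scale (minus_ops m\<^sub>0 X)" for X
    by (cases X) (simp_all add: linear_wshift)
  show "minus_ops m\<^sub>0 Bminus (minus_ops m\<^sub>0 Bplus x) - minus_ops m\<^sub>0 Bplus (minus_ops m\<^sub>0 Bminus x) =
          minus_ops m\<^sub>0 Mgen x" for x
    unfolding eq M using arg_cong[OF p.rel_M[of x], of uminus] by (simp del: plus_ops.simps)
  show "minus_ops m\<^sub>0 Mgen (minus_ops m\<^sub>0 Bplus x) - minus_ops m\<^sub>0 Bplus (minus_ops m\<^sub>0 Mgen x) =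
          fs_scale 2 (minus_ops m\<^sub>0 Bplus x)" for x
    unfolding eq M using arg_cong[OF p.rel_minus[of x], of uminus] by (simp add: neg del: plus_ops.simps) (simp add: neg)
  show "minus_ops m\<^sub>0 Mgen (minus_ops m\<^sub>0 Bminus x) - minus_ops m\<^sub>0 Bminus (minus_ops m\<^sub>0 Mgen x) =
          - fs_scale 2 (minus_ops m\<^sub>0 Bminus x)" for x
    unfolding eq M using arg_cong[OF p.rel_plus[of x], of uminus] by (simp add: neg del: plus_ops.simps) (simp add: neg)
qed

lemma bilateral_nonneg:
  assumes "0 \<le> m\<^sub>0" "m\<^sub>0 < 2" "c < m\<^sub>0 * (m\<^sub>0 - 2)"
  shows "0 \<le> (m\<^sub>0 + 2 * real_of_int n + 2) * (m\<^sub>0 + 2 * real_of_int n) - c"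
proof -
  have "m\<^sub>0 * (m\<^sub>0 - 2) \<le> (m\<^sub>0 + 2 * real_of_int n + 2) * (m\<^sub>0 + 2 * real_of_int n)"
  proof (cases "n \<ge> 0")
    case True
    have "m\<^sub>0 * (m\<^sub>0 - 2) \<le> 0" using assms by (simp add: mult_nonneg_nonpos)
    also have "0 \<le> (m\<^sub>0 + 2 * real_of_int n + 2) * (m\<^sub>0 + 2 * real_of_int n)"
      using True assms by simp
    finally show ?thesis .
  next
    case False
    then have le: "n + 1 \<le> 0" by linarith
    have "0 \<le> (- (real_of_int n + 1)) * (1 - m\<^sub>0 - (real_of_int n + 1)) "
    proof (cases "n = -1")
      case False
      with le have "n + 1 \<le> - 1" by linarith
      then have "real_of_int n + 1 \<le> - 1" by linarith
      then show ?thesis using assms by (intro mult_nonneg_nonneg) auto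
    qed simp
    then show ?thesis by (simp add: algebra_simps)
  qed
  then show ?thesis using assms by linarith
qed

lemma sl2_operators_bilateral:
  assumes "0 \<le> m\<^sub>0" "m\<^sub>0 < 2" "c < m\<^sub>0 * (m\<^sub>0 - 2)"
  shows "sl2_operators fs_scale (bilateral_ops c m\<^sub>0)"
proof (intro sl2_operators.intro vector_space_fs sl2_operators_axioms.intro)
  show "Vector_Spaces.linear fs_scale fs_scale (bilateral_ops c m\<^sub>0 X)" for X
    by (cases X) (simp_all add: linear_wshift)
  show "bilateral_ops c m\<^sub>0 Bminus (bilateral_ops c m\<^sub>0 Bplus x) -
        bilateral_ops c m\<^sub>0 Bplus (bilateral_ops c m\<^sub>0 Bminus x) = bilateral_ops c m\<^sub>0 Mgen x" for x
    unfolding bilateral_ops.simps wshift_wshift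
  proof (rule wshift_diff, goal_cases)
    case (1 n)
    define P where "P = (m\<^sub>0 + 2 * real_of_int n + 2) * (m\<^sub>0 + 2 * real_of_int n) - c"
    define Q where "Q = (m\<^sub>0 + 2 * real_of_int n - 2) * (m\<^sub>0 + 2 * real_of_int n) - c"
    have P: "(m\<^sub>0 + 2 * real_of_int (n + 1) - 2) * (m\<^sub>0 + 2 * real_of_int (n + 1)) - c = P"
      by (simp add: P_def algebra_simps)
    have Q: "(m\<^sub>0 + 2 * real_of_int (n - 1) + 2) * (m\<^sub>0 + 2 * real_of_int (n - 1)) - c = Q"
      by (simp add: Q_def algebra_simps)
    have nonneg: "0 \<le> P" "0 \<le> Q"
      using bilateral_nonneg[OF assms, of n] bilateral_nonneg[OF assms, of "n - 1"]
      unfolding P_def[symmetric] Q by auto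
    have *: "complex_of_real (1 / 2 * sqrt r) * complex_of_real (1 / 2 * sqrt r) = complex_of_real (r / 4)"
      if "0 \<le> r" for r
    proof -
      have "(1 / 2 * sqrt r) * (1 / 2 * sqrt r) = r / 4" using that by simp
      then show ?thesis by (metis of_real_mult)
    qed
    have "P - Q = 4 * (2 * real_of_int n + m\<^sub>0)"
      by (simp add: P_def Q_def algebra_simps)
    then have "P / 4 - Q / 4 = 2 * real_of_int n + m\<^sub>0" by simp
    then show ?case
      unfolding P Q P_def[symmetric] Q_def[symmetric] *[OF nonneg(1)] *[OF nonneg(2)]
      by (simp add: single_diff' del: of_real_add of_real_divide flip: of_real_diff)
  qed
  show "bilateral_ops c m\<^sub>0 Mgen (bilateral_ops c m\<^sub>0 Bplus x) -
        bilateral_ops c m\<^sub>0 Bplus (bilateral_ops c m\<^sub>0 Mgen x) = fs_scale 2 (bilateral_ops c m\<^sub>0 Bplus x)" for x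
    unfolding bilateral_ops.simps wshift_wshift fs_scale_wshift
    by (rule wshift_diff) (simp add: single_diff' algebra_simps flip: diff_divide_distrib)
  show "bilateral_ops c m\<^sub>0 Mgen (bilateral_ops c m\<^sub>0 Bminus x) -
        bilateral_ops c m\<^sub>0 Bminus (bilateral_ops c m\<^sub>0 Mgen x) = - fs_scale 2 (bilateral_ops c m\<^sub>0 Bminus x)" for x
    unfolding bilateral_ops.simps wshift_wshift minus_fs_scale_wshift
    by (rule wshift_diff) (simp add: single_diff' algebra_simps flip: diff_divide_distrib)
qed

lemma vector_space_complex: "vector_space ((*) :: complex \<Rightarrow> complex \<Rightarrow> complex)"
  by standard (simp_all add: algebra_simps)

lemma sl2_operators_trivial: "sl2_operators (*) (\<lambda>X (x::complex). 0)"
  using vector_space_complex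
  by (simp add: sl2_operators_def sl2_operators_axioms_def Vector_Spaces.linear_def module_hom_def
      module_hom_axioms_def vector_space_def module_def)

lemma U0_star_representation_U_act:
  assumes "pre_hilbert scale ip" "sl2_operators scale f"
    and "\<And>X x y. ip (f X x) y = ip x (f (basis_star X) y)"
  shows "U0_star_representation scale ip (U_act scale f)"
proof -
  interpret pre_hilbert scale ip by fact
  interpret sl2_operators scale f by fact
  show ?thesis by unfold_locales (simp add: U_act_ugen assms(3))
qed

lemma unitarily_equivalent_refl:
  "vector_space scale \<Longrightarrow> unitarily_equivalent scale ip \<rho> scale ip \<rho>"
  unfolding unitarily_equivalent_def
  by (rule exI[of _ id]) (simp add: vector_space.linear_id)

lemma integrable_trivial: "integrable_unitary_irrep (*) complex_ip rho_trivial"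
proof -
  have "pre_hilbert (*) complex_ip"
    by (intro pre_hilbert.intro vector_space_complex pre_hilbert_axioms.intro)
       (auto simp: complex_ip_def algebra_simps complex_neq_0 power2_eq_square[symmetric])
  then have "U0_star_representation (*) complex_ip rho_trivial"
    unfolding rho_trivial_def
    by (rule U0_star_representation_U_act[OF _ sl2_operators_trivial]) (simp add: complex_ip_def)
  then show ?thesis
    by (simp add: integrable_unitary_irrep_def unitarily_equivalent_refl vector_space_complex)
qed

lemma integrable_plus:
  assumes "m\<^sub>0 > 0"
  shows "integrable_unitary_irrep fs_scale fs_ip (rho_plus m\<^sub>0)"
proof -
  have up: "fs_ip (plus_ops m\<^sub>0 Bplus x) y = fs_ip x (plus_ops m\<^sub>0 Bminus y)" for x y
    unfolding plus_ops.simps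
  proof (rule wshift_adjoint, goal_cases)
    case (1 i j c d)
    show ?case by (cases j) (auto simp: fs_ip_single add_ac)
  qed
  have down: "fs_ip (plus_ops m\<^sub>0 Bminus x) y = fs_ip x (plus_ops m\<^sub>0 Bplus y)" for x y
    unfolding plus_ops.simps
  proof (rule wshift_adjoint, goal_cases)
    case (1 i j c d)
    show ?case by (cases i) (auto simp: fs_ip_single add_ac)
  qed
  have M: "fs_ip (plus_ops m\<^sub>0 Mgen x) y = fs_ip x (plus_ops m\<^sub>0 Mgen y)" for x y
    unfolding plus_ops.simps by (rule wshift_adjoint) (simp add: fs_ip_single)
  have "fs_ip (plus_ops m\<^sub>0 X x) y = fs_ip x (plus_ops m\<^sub>0 (basis_star X) y)" for X x y
    using up down M by (cases X) (simp_all del: plus_ops.simps)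
  then have "U0_star_representation fs_scale fs_ip (rho_plus m\<^sub>0)"
    unfolding rho_plus_def
    by (intro U0_star_representation_U_act pre_hilbert_fs sl2_operators_plus assms)
  then show ?thesis
    using assms unitarily_equivalent_refl[OF vector_space_fs]
    by (auto simp: integrable_unitary_irrep_def)
qed

lemma integrable_minus:
  assumes "m\<^sub>0 > 0"
  shows "integrable_unitary_irrep fs_scale fs_ip (rho_minus m\<^sub>0)"
proof -
  have up: "fs_ip (minus_ops m\<^sub>0 Bminus x) y = fs_ip x (minus_ops m\<^sub>0 Bplus y)" for x y
    unfolding minus_ops.simps
  proof (rule wshift_adjoint, goal_cases)
    case (1 i j c d)
    show ?case by (cases j) (auto simp: fs_ip_single add_ac)
  qed
  have down: "fs_ip (minus_ops m\<^sub>0 Bplus x) y = fs_ip x (minus_ops m\<^sub>0 Bminus y)" for x y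
    unfolding minus_ops.simps
  proof (rule wshift_adjoint, goal_cases)
    case (1 i j c d)
    show ?case by (cases i) (auto simp: fs_ip_single add_ac)
  qed
  have M: "fs_ip (minus_ops m\<^sub>0 Mgen x) y = fs_ip x (minus_ops m\<^sub>0 Mgen y)" for x y
    unfolding minus_ops.simps by (rule wshift_adjoint) (simp add: fs_ip_single)
  have "fs_ip (minus_ops m\<^sub>0 X x) y = fs_ip x (minus_ops m\<^sub>0 (basis_star X) y)" for X x y
    using up down M by (cases X) (simp_all del: minus_ops.simps)
  then have "U0_star_representation fs_scale fs_ip (rho_minus m\<^sub>0)"
    unfolding rho_minus_def
    by (intro U0_star_representation_U_act pre_hilbert_fs sl2_operators_minus assms)
  then show ?thesis
    using assms unitarily_equivalent_refl[OF vector_space_fs]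
    by (auto simp: integrable_unitary_irrep_def)
qed

lemma integrable_bilateral:
  assumes "0 \<le> m\<^sub>0" "m\<^sub>0 < 2" "c < m\<^sub>0 * (m\<^sub>0 - 2)"
  shows "integrable_unitary_irrep fs_scale fs_ip (rho_bilateral c m\<^sub>0)"
proof -
  have up: "fs_ip (bilateral_ops c m\<^sub>0 Bplus x) y = fs_ip x (bilateral_ops c m\<^sub>0 Bminus y)" for x y
    unfolding bilateral_ops.simps
    by (rule wshift_adjoint) (auto simp: fs_ip_single algebra_simps)
  have down: "fs_ip (bilateral_ops c m\<^sub>0 Bminus x) y = fs_ip x (bilateral_ops c m\<^sub>0 Bplus y)" for x y
    unfolding bilateral_ops.simps
    by (rule wshift_adjoint) (auto simp: fs_ip_single algebra_simps)
  have M: "fs_ip (bilateral_ops c m\<^sub>0 Mgen x) y = fs_ip x (bilateral_ops c m\<^sub>0 Mgen y)" for x y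
    unfolding bilateral_ops.simps by (rule wshift_adjoint) (simp add: fs_ip_single)
  have "fs_ip (bilateral_ops c m\<^sub>0 X x) y = fs_ip x (bilateral_ops c m\<^sub>0 (basis_star X) y)" for X x y
    using up down M by (cases X) (simp_all del: bilateral_ops.simps)
  then have "U0_star_representation fs_scale fs_ip (rho_bilateral c m\<^sub>0)"
    unfolding rho_bilateral_def
    by (intro U0_star_representation_U_act pre_hilbert_fs sl2_operators_bilateral assms)
  moreover have "unitarily_equivalent fs_scale fs_ip (rho_bilateral c m\<^sub>0) fs_scale fs_ip (rho_bilateral c m\<^sub>0)"
    by (rule unitarily_equivalent_refl[OF vector_space_fs])
  ultimately show ?thesis
    unfolding integrable_unitary_irrep_def using assms by (intro conjI disjI2 exI) assumption+
qed

end

theory Submission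
  imports Defs "HOL-Library.Product_Plus"
begin

section \<open>Cocycles and their values on the generators\<close>

text \<open>A cocycle \<open>\<eta>\<close> is determined by its values at the three generators
  (\<open>Z1_eqI\<close>), and applying it to the commutation relations yields the identities
  \<open>lie_cocycle\<close> (\<open>Z1_lie_cocycle\<close>). Conversely, every solution of these
  identities extends to \<open>U0\<close> (\<open>lie_cocycle_extends\<close>). This reduces the
  computation to linear algebra with three vectors.

  The Casimir element acts on each listed representation by a scalar:
  \<open>m\<^sub>0 * (m\<^sub>0 - 2)\<close> on the two one-sided families, \<open>c\<close> on the
  bilateral one. Where the scalar is nonzero, every cocycle is a coboundary
  (\<open>casimir_Z1_subset_B1\<close>). It is zero only for the trivial representation, where the
  identities force all three values to vanish, and for the one-sided families at
  \<open>m\<^sub>0 = 2\<close>.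

  In the latter case \<open>Mgen\<close> acts invertibly, with eigenvalues \<open>2 * n + 2\<close>
  up to a common sign, so exactly one coboundary can be subtracted to make the value at
  \<open>Mgen\<close> zero. The values at \<open>Bplus\<close> and \<open>Bminus\<close> are then in
  the eigenspaces of \<open>Mgen\<close> for 2 and -2. Only one of these numbers is an eigenvalue,
  and its eigenspace is the line through \<open>e 0\<close>; this gives dimension one
  (\<open>H1_has_dim_1\<close>).\<close>

definition lie_cocycle ::
  "(complex \<Rightarrow> 'd::ab_group_add \<Rightarrow> 'd) \<Rightarrow> (sl2_basis \<Rightarrow> 'd \<Rightarrow> 'd) \<Rightarrow> (sl2_basis \<Rightarrow> 'd) \<Rightarrow> bool" where
  "lie_cocycle scale f a \<longleftrightarrow>
     f Bminus (a Bplus) - f Bplus (a Bminus) = a Mgen \<and>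
     f Mgen (a Bplus) - f Bplus (a Mgen) = scale 2 (a Bplus) \<and>
     f Mgen (a Bminus) - f Bminus (a Mgen) = - scale 2 (a Bminus)"

lemma sl2_relations_in_ideal: "r \<in> sl2_relations \<Longrightarrow> r \<in> sl2_ideal"
  using sl2_ideal.gen[of r 1 1] by simp

text \<open>Differences are avoided, the sign being absorbed into the scalar \<open>- 2\<close>,
  because a cocycle is by definition compatible with sums, products and scalar multiples in
  \<open>U0\<close>.\<close>

lemma ugen_commutators:
  "ugen Bminus * ugen Bplus = ugen Bplus * ugen Bminus + ugen Mgen"
  "ugen Mgen * ugen Bplus = ugen Bplus * ugen Mgen + uscale 2 (ugen Bplus)"
  "ugen Mgen * ugen Bminus = ugen Bminus * ugen Mgen + uscale (- 2) (ugen Bminus)"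
proof -
  have "tscalar (- 2) = - tscalar 2"
    by (simp add: tscalar_def single_uminus)
  then show "ugen Bminus * ugen Bplus = ugen Bplus * ugen Bminus + ugen Mgen"
    "ugen Mgen * ugen Bplus = ugen Bplus * ugen Mgen + uscale 2 (ugen Bplus)"
    "ugen Mgen * ugen Bminus = ugen Bminus * ugen Mgen + uscale (- 2) (ugen Bminus)"
    by (transfer; intro sl2_relations_in_ideal; simp add: sl2_relations_def algebra_simps)+
qed

lemma Z1_D:
  assumes "\<eta> \<in> Z1 scale \<rho>"
  shows "u \<notin> U0 \<Longrightarrow> \<eta> u = 0"
    and "u \<in> U0 \<Longrightarrow> v \<in> U0 \<Longrightarrow> \<eta> (u + v) = \<eta> u + \<eta> v"
    and "u \<in> U0 \<Longrightarrow> \<eta> (uscale c u) = scale c (\<eta> u)"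
    and "u \<in> U0 \<Longrightarrow> v \<in> U0 \<Longrightarrow> \<eta> (u * v) = \<rho> u (\<eta> v)"
  using assms by (auto simp: Z1_def)

text \<open>Each clause generating \<open>U0\<close> is matched by a cocycle law; for products,
  agreement at the right factor is enough.\<close>

lemma Z1_eqI:
  assumes "\<eta> \<in> Z1 scale \<rho>" "\<zeta> \<in> Z1 scale \<rho>" and eq: "\<And>X. \<eta> (ugen X) = \<zeta> (ugen X)"
  shows "\<eta> = \<zeta>"
proof
  fix u
  show "\<eta> u = \<zeta> u"
  proof (cases "u \<in> U0")
    case True
    then show ?thesis
      by induction (simp_all add: eq Z1_D[OF assms(1)] Z1_D[OF assms(2)])
  qed (simp add: Z1_D(1)[OF assms(1)] Z1_D(1)[OF assms(2)])
qed

section \<open>Operations on cocycles, coboundaries, and vanishing cohomology\<close>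

context U0_representation
begin

lemma coboundary_in_Z1: "(\<lambda>u. if u \<in> U0 then \<rho> u \<omega> else 0) \<in> Z1 scale \<rho>"
  unfolding Z1_def
  by (auto simp: rep_add rep_scale rep_mult intro: U0.intros)

lemma Z1_diff:
  assumes "\<eta> \<in> Z1 scale \<rho>" "\<zeta> \<in> Z1 scale \<rho>"
  shows "(\<lambda>u. \<eta> u - \<zeta> u) \<in> Z1 scale \<rho>"
proof -
  have "\<rho> u (x - y) = \<rho> u x - \<rho> u y" if "u \<in> U0" for u x y
  proof -
    interpret Vector_Spaces.linear scale scale "\<rho> u" by (rule rep_linear[OF that])
    show ?thesis by (rule diff)
  qed
  then show ?thesis
    using assms unfolding Z1_def by (auto simp: scale_right_diff_distrib)
qed

lemma Z1_scale:
  assumes "\<eta> \<in> Z1 scale \<rho>"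
  shows "(\<lambda>u. scale c (\<eta> u)) \<in> Z1 scale \<rho>"
proof -
  have "\<rho> u (scale c x) = scale c (\<rho> u x)" if "u \<in> U0" for u x
  proof -
    interpret l: Vector_Spaces.linear scale scale "\<rho> u" by (rule rep_linear[OF that])
    show ?thesis by (rule l.scale)
  qed
  then show ?thesis
    using assms unfolding Z1_def by (auto simp: scale_right_distrib mult.commute)
qed

lemma B1_I:
  assumes "\<eta> \<in> Z1 scale \<rho>" "\<And>X. \<eta> (ugen X) = \<rho> (ugen X) \<omega>"
  shows "\<eta> \<in> B1 \<rho>"
proof -
  have "\<eta> = (\<lambda>u. if u \<in> U0 then \<rho> u \<omega> else 0)"
    by (rule Z1_eqI[OF assms(1) coboundary_in_Z1]) (simp add: assms(2) U0.gen)
  then show ?thesis by (auto simp: B1_def)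
qed

text \<open>For \<open>n = 0\<close> the empty sum is the zero cochain, which lies in every class
  because each cocycle is itself a coboundary.\<close>

lemma H1_has_dim_0:
  assumes "Z1 scale \<rho> \<subseteq> B1 \<rho>"
  shows "H1_has_dim scale \<rho> 0"
proof -
  have ex1: "\<exists>!c :: nat \<Rightarrow> complex. (\<forall>i\<ge>0. c i = 0) \<and> (\<lambda>u. \<Sum>i<0. scale (c i) (b i u)) \<in> X"
    if "X \<in> H1 scale \<rho>" for X and b :: "nat \<Rightarrow> usl2 \<Rightarrow> 'd"
  proof -
    from that obtain \<eta> where \<eta>: "\<eta> \<in> Z1 scale \<rho>"
      and X: "X = {\<zeta>. \<zeta> \<in> Z1 scale \<rho> \<and> (\<lambda>u. \<eta> u - \<zeta> u) \<in> B1 \<rho>}"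
      unfolding H1_def quotient_def by auto
    have "(\<lambda>u. 0) \<in> Z1 scale \<rho>" using Z1_scale[OF \<eta>, of 0] by simp
    then have "(\<lambda>u. 0) \<in> X" using \<eta> assms by (auto simp: X)
    then show ?thesis by (intro ex1I[of _ "\<lambda>_. 0"]) auto
  qed
  show ?thesis
    unfolding H1_has_dim_def by (intro exI[of _ "\<lambda>_ _. 0"] conjI ballI ex1) simp_all
qed

lemma Z1_lie_cocycle:
  assumes "\<eta> \<in> Z1 scale \<rho>"
  shows "lie_cocycle scale (\<lambda>X. \<rho> (ugen X)) (\<lambda>X. \<eta> (ugen X))"
  using ugen_commutators[THEN arg_cong, of \<eta>]
  by (simp add: lie_cocycle_def Z1_D[OF assms] U0.intros)

end

text \<open>The intertwiner \<open>T\<close> carries a cocycle over; a vector trivializing the image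
  is pulled back by surjectivity, and injectivity shows that it trivializes the original.\<close>

lemma unitarily_equivalent_Z1_subset_B1:
  assumes "unitarily_equivalent scale ip \<rho> scale' ip' \<rho>'" "Z1 scale' \<rho>' \<subseteq> B1 \<rho>'"
  shows "Z1 scale \<rho> \<subseteq> B1 \<rho>"
proof
  fix \<eta> assume \<eta>: "\<eta> \<in> Z1 scale \<rho>"
  from assms(1) obtain T where bij: "bij T" and lin: "Vector_Spaces.linear scale scale' T"
    and T: "\<And>u x. u \<in> U0 \<Longrightarrow> T (\<rho> u x) = \<rho>' u (T x)"
    unfolding unitarily_equivalent_def by blast
  interpret T: Vector_Spaces.linear scale scale' T by (rule lin)
  have "(\<lambda>u. T (\<eta> u)) \<in> Z1 scale' \<rho>'"
    using \<eta> unfolding Z1_def by (auto simp: T T.add T.scale T.zero)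
  with assms(2) obtain \<omega> where \<omega>: "(\<lambda>u. T (\<eta> u)) = (\<lambda>u. if u \<in> U0 then \<rho>' u \<omega> else 0)"
    unfolding B1_def by blast
  obtain \<omega>' where \<omega>': "\<omega> = T \<omega>'" using bij by (meson bij_pointE)
  have "\<eta> u = (if u \<in> U0 then \<rho> u \<omega>' else 0)" for u
  proof (cases "u \<in> U0")
    case True
    then have "T (\<eta> u) = T (\<rho> u \<omega>')" using fun_cong[OF \<omega>, of u] by (simp add: T \<omega>')
    then show ?thesis using True bij by (simp add: bij_is_inj inj_eq)
  qed (simp add: Z1_D(1)[OF \<eta>])
  then show "\<eta> \<in> B1 \<rho>" unfolding B1_def by blast
qed

section \<open>Extension of Lie algebra cocycles, the Casimir argument, and normalization at
  \<open>Mgen\<close>\<close>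

context sl2_operators
begin

text \<open>
  A Lie algebra cocycle \<open>a\<close> makes \<open>D \<times> \<complex>\<close> an extension of the trivial representation by \<open>D\<close>; the
  cocycle on the enveloping algebra is the action on the vector \<open>(0, 1)\<close>.
\<close>

lemma lie_cocycle_extends:
  assumes "lie_cocycle scale f a"
  obtains \<eta> where "\<eta> \<in> Z1 scale (U_act scale f)" "\<And>X. \<eta> (ugen X) = a X"
proof -
  interpret l: Vector_Spaces.linear scale scale "f X" for X by (rule lin)
  define s where "s = (\<lambda>c (x :: 'd \<times> complex). (scale c (fst x), c * snd x))"
  \<comment> \<open>Block triangular operators: \<open>f X\<close> on the first summand,
    \<open>a X\<close> from the second to the first, zero on the quotient.\<close>
  define g where "g = (\<lambda>X (x :: 'd \<times> complex). (f X (fst x) + scale (snd x) (a X), 0 :: complex))"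
  have vs: "vector_space s"
    by standard (auto simp: s_def scale_right_distrib scale_left_distrib algebra_simps)
  interpret vs: vector_space s by (rule vs)
  have rel: "a Mgen = f Bminus (a Bplus) - f Bplus (a Bminus)"
    "f Mgen (a Bplus) = f Bplus (a Mgen) + scale 2 (a Bplus)"
    "f Mgen (a Bminus) = f Bminus (a Mgen) - scale 2 (a Bminus)"
    using assms by (auto simp: lie_cocycle_def algebra_simps)
  \<comment> \<open>On the first summand these are the relations for \<open>f\<close>; on
    \<open>(0, 1)\<close> they are the cocycle identities.\<close>
  have "sl2_operators s g"
  proof
    show "g X (x + y) = g X x + g X y" for X x y
      by (simp add: g_def l.add scale_left_distrib)
    show "g X (s c x) = s c (g X x)" for X c x
      by (simp add: g_def s_def l.scale scale_right_distrib)
    show "g Bminus (g Bplus x) - g Bplus (g Bminus x) = g Mgen x" for x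
      using rel_M[of "fst x"]
      by (simp add: g_def l.add l.scale rel(1) scale_right_diff_distrib)
    show "g Mgen (g Bplus x) - g Bplus (g Mgen x) = s 2 (g Bplus x)" for x
      using rel_plus[of "fst x"]
      by (simp add: g_def s_def l.add l.scale rel(2) scale_right_distrib mult.commute algebra_simps)
    show "g Mgen (g Bminus x) - g Bminus (g Mgen x) = - s 2 (g Bminus x)" for x
      using rel_minus[of "fst x"]
      by (simp add: g_def s_def l.add l.scale rel(3) scale_right_distrib scale_right_diff_distrib
          mult.commute algebra_simps)
  qed
  then interpret g: sl2_operators s g .
  have base: "U_act s g u (x, 0) = (U_act scale f u x, 0)" if "u \<in> U0" for u x
    using that
    by (induction arbitrary: x)
       (simp_all add: g.U_act_ugen U_act_ugen g.U_act_scale U_act_scale g.U_act_add U_act_add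
          g.U_act_mult U_act_mult, simp_all add: g_def s_def)
  \<comment> \<open>The quotient by the first summand is the trivial representation, which
    \<open>U0\<close> annihilates.\<close>
  have snd: "snd (U_act s g u (0, 1)) = 0" if "u \<in> U0" for u
    using that
  proof induction
    case (mult u v)
    then have "U_act s g v (0, 1) = (fst (U_act s g v (0, 1)), 0)"
      by (simp add: prod_eq_iff)
    then show ?case using base[OF mult.hyps(1)] by (metis g.U_act_mult snd_conv)
  qed (simp_all add: g.U_act_ugen g.U_act_scale g.U_act_add, simp_all add: g_def s_def)
  define \<eta> where "\<eta> = (\<lambda>u. if u \<in> U0 then fst (U_act s g u (0, 1)) else 0)"
  have val: "U_act s g u (0, 1) = (\<eta> u, 0)" if "u \<in> U0" for u
    using snd[OF that] that by (simp add: \<eta>_def prod_eq_iff)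
  have "\<eta> (u + v) = \<eta> u + \<eta> v" if "u \<in> U0" "v \<in> U0" for u v
    using val[OF U0.add[OF that]] by (simp add: g.U_act_add val that)
  moreover have "\<eta> (uscale c u) = scale c (\<eta> u)" if "u \<in> U0" for c u
    using val[OF U0.scale[OF that]] by (simp add: g.U_act_scale val that) (simp add: s_def)
  moreover have "\<eta> (u * v) = U_act scale f u (\<eta> v)" if "u \<in> U0" "v \<in> U0" for u v
    using val[OF U0.mult[OF that]] by (simp add: g.U_act_mult val base that)
  ultimately have "\<eta> \<in> Z1 scale (U_act scale f)"
    by (simp add: Z1_def \<eta>_def)
  moreover have "\<eta> (ugen X) = a X" for X
    by (simp add: \<eta>_def U0.gen g.U_act_ugen) (simp add: g_def l.zero)
  ultimately show ?thesis by (rule that)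
qed

lemma Z1_generators: "\<eta> \<in> Z1 scale (U_act scale f) \<Longrightarrow> lie_cocycle scale f (\<lambda>X. \<eta> (ugen X))"
  using Z1_lie_cocycle[of \<eta>] by (simp add: U_act_ugen lie_cocycle_def)

text \<open>
  The Casimir element \<open>C = M\<^sup>2 - 2M - 4B\<^sup>+B\<^sup>-\<close> is central, so \<open>\<rho>(C) \<eta>(u) = \<eta>(C u) = \<eta>(u C) = \<rho>(u) \<eta>(C)\<close>;
  if \<open>\<rho>(C) = k \<noteq> 0\<close> then \<open>\<eta>\<close> is the coboundary of \<open>\<eta>(C) / k\<close>.
\<close>

lemma casimir_Z1_subset_B1:
  assumes casimir: "\<And>x. f Mgen (f Mgen x) - scale 2 (f Mgen x) - scale 4 (f Bplus (f Bminus x)) = scale k x"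
    and "k \<noteq> 0"
  shows "Z1 scale (U_act scale f) \<subseteq> B1 (U_act scale f)"
proof
  fix \<eta> assume \<eta>: "\<eta> \<in> Z1 scale (U_act scale f)"
  interpret l: Vector_Spaces.linear scale scale "f X" for X by (rule lin)
  define a where "a = \<eta> (ugen Bplus)"
  define b where "b = \<eta> (ugen Bminus)"
  define m where "m = \<eta> (ugen Mgen)"
  have Bpb: "f Bplus b = f Bminus a - m"
    and Bpm: "f Bplus m = f Mgen a - scale 2 a"
    and Bmm: "f Bminus m = f Mgen b + scale 2 b"
    using Z1_generators[OF \<eta>] by (auto simp: lie_cocycle_def a_def b_def m_def algebra_simps)
  have MBp: "f Mgen (f Bplus x) = f Bplus (f Mgen x) + scale 2 (f Bplus x)"
    and MBm: "f Mgen (f Bminus x) = f Bminus (f Mgen x) - scale 2 (f Bminus x)"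
    and BmBp: "f Bminus (f Bplus x) = f Bplus (f Bminus x) + f Mgen x" for x
    using rel_M[of x] rel_plus[of x] rel_minus[of x] by (simp_all add: algebra_simps)
  \<comment> \<open>Rewriting the scalars 2 and 4 as repeated sums lets \<open>algebra_simps\<close>
    cancel terms in the additive group.\<close>
  have two: "scale 4 x = scale 2 (scale 2 x)" "scale 2 x = x + x" for x
    using scale_left_distrib[of 1 1 x] by (simp_all only: scale_scale) simp_all
  \<comment> \<open>This is the value of \<open>\<eta>\<close> at the Casimir element, with the left
    factor of each product moved out as an operator. Its image under each generator is computed from
    the cocycle and commutation relations.\<close>
  define \<omega> where "\<omega> = f Mgen m - scale 2 m - scale 4 (f Bplus b)"
  have cas: "scale k x = f Mgen (f Mgen x) - scale 2 (f Mgen x) - scale 4 (f Bplus (f Bminus x))" for x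
    using casimir[of x] by simp
  note lin_simps = l.add l.diff l.scale scale_right_distrib scale_right_diff_distrib
  have M: "f Mgen \<omega> = scale k m"
  proof -
    have "f Mgen (f Bplus b) = f Bplus (f Bminus m)"
      by (simp add: MBp Bmm lin_simps)
    then show ?thesis by (simp add: \<omega>_def cas lin_simps)
  qed
  have P: "f Bplus \<omega> = scale k a"
  proof -
    have "f Bplus (f Mgen m) = f Mgen (f Mgen a) - scale 4 (f Mgen a) + scale 4 a"
    proof -
      have "f Bplus (f Mgen m) = f Mgen (f Bplus m) - scale 2 (f Bplus m)" by (simp add: MBp)
      then show ?thesis unfolding Bpm by (simp add: lin_simps two algebra_simps)
    qed
    moreover have "f Bplus (f Bplus b) = f Bplus (f Bminus a) - f Mgen a + scale 2 a"
      unfolding Bpb l.diff Bpm by simp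
    ultimately show ?thesis
      unfolding \<omega>_def cas by (simp only: lin_simps Bpm) (simp add: two algebra_simps)
  qed
  have N: "f Bminus \<omega> = scale k b"
  proof -
    have "f Bminus (f Mgen m) = f Mgen (f Mgen b) + scale 4 (f Mgen b) + scale 4 b"
    proof -
      have "f Bminus (f Mgen m) = f Mgen (f Bminus m) + scale 2 (f Bminus m)" by (simp add: MBm)
      then show ?thesis unfolding Bmm by (simp add: lin_simps two algebra_simps)
    qed
    then show ?thesis
      unfolding \<omega>_def cas by (simp only: lin_simps Bmm BmBp) (simp add: two algebra_simps)
  qed
  have "\<eta> (ugen X) = U_act scale f (ugen X) (scale (1 / k) \<omega>)" for X
    using M P N \<open>k \<noteq> 0\<close>
    by (cases X) (simp_all add: U_act_ugen l.scale a_def b_def m_def)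
  then show "\<eta> \<in> B1 (U_act scale f)" by (rule B1_I[OF \<eta>])
qed

text \<open>
  Modulo coboundaries the value at \<open>M\<close> can be made \<open>0\<close>, and this normalization is unique when \<open>M\<close> acts
  bijectively.
\<close>

lemma H1_has_dim_1:
  assumes "bij (f Mgen)"
    and a\<^sub>0: "lie_cocycle scale f a\<^sub>0" "a\<^sub>0 Mgen = 0" "a\<^sub>0 X\<^sub>0 \<noteq> 0"
    and unique: "\<And>a. lie_cocycle scale f a \<Longrightarrow> a Mgen = 0 \<Longrightarrow> \<exists>c. \<forall>X. a X = scale c (a\<^sub>0 X)"
  shows "H1_has_dim scale (U_act scale f) 1"
proof -
  interpret l: Vector_Spaces.linear scale scale "f X" for X by (rule lin)
  let ?\<rho> = "U_act scale f"
  obtain \<beta> where \<beta>: "\<beta> \<in> Z1 scale ?\<rho>" "\<And>X. \<beta> (ugen X) = a\<^sub>0 X"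
    using lie_cocycle_extends[OF a\<^sub>0(1)] by blast
  have ex1: "\<exists>!c :: nat \<Rightarrow> complex. (\<forall>i\<ge>1. c i = 0) \<and> (\<lambda>u. \<Sum>i<1. scale (c i) (\<beta> u)) \<in> X"
    if "X \<in> H1 scale ?\<rho>" for X
  proof -
    from that obtain \<eta> where \<eta>: "\<eta> \<in> Z1 scale ?\<rho>"
      and X: "X = {\<zeta>. \<zeta> \<in> Z1 scale ?\<rho> \<and> (\<lambda>u. \<eta> u - \<zeta> u) \<in> B1 ?\<rho>}"
      unfolding H1_def quotient_def by auto
    \<comment> \<open>Surjectivity of \<open>f Mgen\<close> supplies the coboundary that cancels the
      value at \<open>Mgen\<close>.\<close>
    obtain \<omega> where \<omega>: "\<eta> (ugen Mgen) = f Mgen \<omega>" using assms(1) by (meson bij_pointE)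
    define a where "a X = \<eta> (ugen X) - f X \<omega>" for X
    have "lie_cocycle scale f a"
      using Z1_generators[OF \<eta>] rel_M[of \<omega>] rel_plus[of \<omega>] rel_minus[of \<omega>]
      by (simp add: lie_cocycle_def a_def l.diff scale_right_diff_distrib algebra_simps)
    moreover have "a Mgen = 0" by (simp add: a_def \<omega>)
    ultimately obtain k where k: "\<And>X. a X = scale k (a\<^sub>0 X)" using unique by blast
    have mem: "(\<lambda>u. scale d (\<beta> u)) \<in> X \<longleftrightarrow> d = k" for d
    proof
      have "(\<lambda>u. \<eta> u - scale k (\<beta> u)) \<in> B1 ?\<rho>"
      proof (rule B1_I)
        show "\<eta> (ugen X) - scale k (\<beta> (ugen X)) = ?\<rho> (ugen X) \<omega>" for X
          using k[of X] by (simp add: \<beta>(2) U_act_ugen a_def algebra_simps)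
      qed (intro Z1_diff Z1_scale \<eta> \<beta>)
      then show "(\<lambda>u. scale d (\<beta> u)) \<in> X" if "d = k"
        using Z1_scale[OF \<beta>(1), of k] by (simp add: X that)
      assume "(\<lambda>u. scale d (\<beta> u)) \<in> X"
      then obtain \<omega>' where "(\<lambda>u. \<eta> u - scale d (\<beta> u)) = (\<lambda>u. if u \<in> U0 then ?\<rho> u \<omega>' else 0)"
        by (auto simp: X B1_def)
      from fun_cong[OF this] have \<omega>': "\<eta> (ugen X) - scale d (a\<^sub>0 X) = f X \<omega>'" for X
        by (metis \<beta>(2) U0.gen U_act_ugen)
      \<comment> \<open>At \<open>Mgen\<close>, where \<open>a\<^sub>0\<close> vanishes,
        \<open>d\<close> drops out; injectivity then identifies the two vectors, and
        \<open>X\<^sub>0\<close> separates the coefficients.\<close>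
      have "f Mgen \<omega> = f Mgen \<omega>'" using \<omega>'[of Mgen] by (simp add: a\<^sub>0 \<omega>)
      then have "\<omega> = \<omega>'" using assms(1) by (simp add: bij_is_inj inj_eq)
      then have "scale d (a\<^sub>0 X\<^sub>0) = scale k (a\<^sub>0 X\<^sub>0)"
        using k[of X\<^sub>0] \<omega>'[of X\<^sub>0] by (metis a_def add_diff_cancel_left' diff_add_cancel diff_diff_eq2)
      then show "d = k" using a\<^sub>0(3) by simp
    qed
    show ?thesis
      by (rule ex1I[of _ "\<lambda>i. if i = 0 then k else 0"])
         (auto simp: mem fun_eq_iff lessThan_Suc)
  qed
  show ?thesis
    unfolding H1_has_dim_def
    by (rule exI[of _ "\<lambda>_. \<beta>"]) (use \<beta>(1) ex1 in auto)
qed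

end


section \<open>The individual representations\<close>

text \<open>With zero operators the cocycle identities read \<open>a Mgen = 0\<close>,
  \<open>2 * a Bplus = 0\<close> and \<open>2 * a Bminus = 0\<close>: the Lie algebra is
  perfect.\<close>

lemma Z1_subset_B1_trivial: "Z1 (*) rho_trivial \<subseteq> B1 rho_trivial"
proof
  interpret sl2_operators "(*)" "\<lambda>X (x::complex). 0" by (rule sl2_operators_trivial)
  fix \<eta> assume "\<eta> \<in> Z1 (*) rho_trivial"
  then have \<eta>: "\<eta> \<in> Z1 (*) (U_act (*) (\<lambda>X (x::complex). 0))" by (simp add: rho_trivial_def)
  have "\<eta> (ugen X) = 0" for X
    using Z1_generators[OF \<eta>] by (cases X) (auto simp: lie_cocycle_def)
  then show "\<eta> \<in> B1 rho_trivial"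
    unfolding rho_trivial_def by (intro B1_I[OF \<eta>]) (simp add: U_act_ugen)
qed

section \<open>Casimir scalars of the infinite-dimensional families\<close>

lemma wshift_diagonal_lookup:
  "Poly_Mapping.lookup (wshift (\<lambda>i. i) a x) i = a i * Poly_Mapping.lookup x i"
  by (induction x rule: fs_induct)
     (auto simp: wshift_add wshift_single lookup_add distrib_left lookup_single when_def)

text \<open>When \<open>Bplus Bminus\<close> is diagonal with entries \<open>e i\<close>, the
  Casimir identity is a scalar identity at each basis vector. Comparing \<open>single\<close> terms,
  not indices, allows \<open>s (t i)\<close> to differ from \<open>i\<close> where the coefficient
  is zero.\<close>

lemma casimir_wshift:
  assumes "\<And>i. Poly_Mapping.single (s (t i)) (a (t i) * b i) = Poly_Mapping.single i (e i)"
    and "\<And>i. d i * d i - 2 * d i - 4 * e i = k"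
  shows "wshift (\<lambda>i. i) d (wshift (\<lambda>i. i) d x) - fs_scale 2 (wshift (\<lambda>i. i) d x)
    - fs_scale 4 (wshift s a (wshift t b x)) = fs_scale k x"
proof -
  have "wshift s a (wshift t b x) = wshift (\<lambda>i. i) e x"
    unfolding wshift_wshift
    by (induction x rule: fs_induct)
       (simp_all add: wshift_add wshift_single assms(1) fs_scale_single flip: mult.assoc,
        metis assms(1) fs_scale_single mult.commute)
  moreover have "d i * (d i * y) - 2 * (d i * y) - 4 * (e i * y) = k * y" for i y
    unfolding assms(2)[of i, symmetric] by (simp add: algebra_simps)
  ultimately show ?thesis
    by (intro poly_mapping_eqI) (simp add: lookup_minus wshift_diagonal_lookup)
qed

lemma Z1_subset_B1_plus:
  assumes "m\<^sub>0 > 0" "m\<^sub>0 \<noteq> 2"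
  shows "Z1 fs_scale (rho_plus m\<^sub>0) \<subseteq> B1 (rho_plus m\<^sub>0)"
  unfolding rho_plus_def
proof (rule sl2_operators.casimir_Z1_subset_B1[OF sl2_operators_plus[OF assms(1)]])
  show "complex_of_real (m\<^sub>0 * (m\<^sub>0 - 2)) \<noteq> 0"
    using assms unfolding of_real_eq_0_iff by simp
  show "plus_ops m\<^sub>0 Mgen (plus_ops m\<^sub>0 Mgen x) - fs_scale 2 (plus_ops m\<^sub>0 Mgen x)
      - fs_scale 4 (plus_ops m\<^sub>0 Bplus (plus_ops m\<^sub>0 Bminus x)) =
      fs_scale (complex_of_real (m\<^sub>0 * (m\<^sub>0 - 2))) x" for x
    unfolding plus_ops.simps
  proof (rule casimir_wshift[where e = "\<lambda>n. complex_of_real (real n * (real n + m\<^sub>0 - 1))"], goal_cases)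
    case (1 n)
    \<comment> \<open>At \<open>n = 0\<close> the truncated predecessor gives index 1 instead of 0,
      but both coefficients are zero.\<close>
    show ?case
    proof (cases n)
      case (Suc j)
      have "0 \<le> (1 + real j) * (real j + m\<^sub>0)" using assms by simp
      then show ?thesis using Suc by (simp add: of_real_sqrt_sqrt add_ac del: of_real_mult)
    qed simp
  qed (simp add: algebra_simps)
qed

lemma Z1_subset_B1_minus:
  assumes "m\<^sub>0 > 0" "m\<^sub>0 \<noteq> 2"
  shows "Z1 fs_scale (rho_minus m\<^sub>0) \<subseteq> B1 (rho_minus m\<^sub>0)"
  unfolding rho_minus_def
proof (rule sl2_operators.casimir_Z1_subset_B1[OF sl2_operators_minus[OF assms(1)]])
  show "complex_of_real (m\<^sub>0 * (m\<^sub>0 - 2)) \<noteq> 0"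
    using assms unfolding of_real_eq_0_iff by simp
  show "minus_ops m\<^sub>0 Mgen (minus_ops m\<^sub>0 Mgen x) - fs_scale 2 (minus_ops m\<^sub>0 Mgen x)
      - fs_scale 4 (minus_ops m\<^sub>0 Bplus (minus_ops m\<^sub>0 Bminus x)) =
      fs_scale (complex_of_real (m\<^sub>0 * (m\<^sub>0 - 2))) x" for x
    unfolding minus_ops.simps
  \<comment> \<open>Here \<open>Bminus\<close> raises the index, so \<open>e n\<close> is the square
    of the raising coefficient.\<close>
  proof (rule casimir_wshift[where e = "\<lambda>n. complex_of_real ((real n + 1) * (real n + m\<^sub>0))"], goal_cases)
    case (1 n)
    have "0 \<le> (1 + real n) * (real n + m\<^sub>0)" using assms by simp
    then show ?case by (simp add: of_real_sqrt_sqrt add_ac del: of_real_mult)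
  qed (simp add: algebra_simps)
qed

lemma Z1_subset_B1_bilateral:
  assumes "0 \<le> m\<^sub>0" "m\<^sub>0 < 2" "c < m\<^sub>0 * (m\<^sub>0 - 2)"
  shows "Z1 fs_scale (rho_bilateral c m\<^sub>0) \<subseteq> B1 (rho_bilateral c m\<^sub>0)"
  unfolding rho_bilateral_def
proof (rule sl2_operators.casimir_Z1_subset_B1[OF sl2_operators_bilateral[OF assms]])
  have "m\<^sub>0 * (m\<^sub>0 - 2) \<le> 0" using assms by (simp add: mult_nonneg_nonpos)
  then show "complex_of_real c \<noteq> 0" using assms by simp
  show "bilateral_ops c m\<^sub>0 Mgen (bilateral_ops c m\<^sub>0 Mgen x) - fs_scale 2 (bilateral_ops c m\<^sub>0 Mgen x)
      - fs_scale 4 (bilateral_ops c m\<^sub>0 Bplus (bilateral_ops c m\<^sub>0 Bminus x)) =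
      fs_scale (complex_of_real c) x" for x
    unfolding bilateral_ops.simps
  proof (rule casimir_wshift[where e = "\<lambda>n. complex_of_real
        (((m\<^sub>0 + 2 * real_of_int n - 2) * (m\<^sub>0 + 2 * real_of_int n) - c) / 4)"], goal_cases)
    case (1 n)
    define r where "r = (m\<^sub>0 + 2 * real_of_int n - 2) * (m\<^sub>0 + 2 * real_of_int n) - c"
    \<comment> \<open>The raising coefficient at \<open>n - 1\<close> equals the lowering
      coefficient at \<open>n\<close>.\<close>
    have r: "(m\<^sub>0 + 2 * real_of_int (n - 1) + 2) * (m\<^sub>0 + 2 * real_of_int (n - 1)) - c = r"
      by (simp add: r_def algebra_simps)
    have "0 \<le> r" using bilateral_nonneg[OF assms, of "n - 1"] unfolding r .
    then have "(1 / 2 * sqrt r) * (1 / 2 * sqrt r) = r / 4" by simp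
    then show ?case unfolding r r_def[symmetric] by (metis diff_add_cancel of_real_mult)
  next
    case (2 n)
    show ?case by (simp add: field_simps)
  qed
qed

section \<open>Eigenvectors of \<open>Mgen\<close> and the two representations with
  \<open>m\<^sub>0 = 2\<close>\<close>

lemma bij_wshift_diagonal:
  assumes "\<And>i. a i \<noteq> 0"
  shows "bij (wshift (\<lambda>i. i) a)"
proof (rule o_bij)
  show "wshift (\<lambda>i. i) (\<lambda>i. inverse (a i)) \<circ> wshift (\<lambda>i. i) a = id"
    "wshift (\<lambda>i. i) a \<circ> wshift (\<lambda>i. i) (\<lambda>i. inverse (a i)) = id"
    using assms by (auto simp: fun_eq_iff wshift_diagonal_lookup intro!: poly_mapping_eqI)
qed

lemma wshift_diagonal_eigenvector:
  assumes "wshift (\<lambda>i. i) a x = fs_scale k x" "\<And>i. i \<noteq> j \<Longrightarrow> a i \<noteq> k"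
  shows "x = fs_scale (Poly_Mapping.lookup x j) (Poly_Mapping.single j 1)"
proof (rule poly_mapping_eqI)
  fix i
  have "(a i - k) * Poly_Mapping.lookup x i = 0"
    using arg_cong[OF assms(1), of "\<lambda>y. Poly_Mapping.lookup y i"]
    by (simp add: wshift_diagonal_lookup algebra_simps)
  then show "Poly_Mapping.lookup x i =
      Poly_Mapping.lookup (fs_scale (Poly_Mapping.lookup x j) (Poly_Mapping.single j 1)) i"
    using assms(2)[of i] by (cases "i = j") (auto simp: lookup_single)
qed

lemma wshift_diagonal_no_eigenvector:
  assumes "wshift (\<lambda>i. i) a x = fs_scale k x" "\<And>i. a i \<noteq> k"
  shows "x = 0"
proof (rule poly_mapping_eqI)
  fix i
  have "(a i - k) * Poly_Mapping.lookup x i = 0"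
    using arg_cong[OF assms(1), of "\<lambda>y. Poly_Mapping.lookup y i"]
    by (simp add: wshift_diagonal_lookup algebra_simps)
  then show "Poly_Mapping.lookup x i = Poly_Mapping.lookup 0 i"
    using assms(2)[of i] by simp
qed

lemma H1_has_dim_1_plus: "H1_has_dim fs_scale (rho_plus 2) 1"
  unfolding rho_plus_def
proof (rule sl2_operators.H1_has_dim_1[OF sl2_operators_plus])
  let ?e = "Poly_Mapping.single 0 1 :: nat \<Rightarrow>\<^sub>0 complex"
  \<comment> \<open>\<open>e 0\<close> satisfies the identities because \<open>Bminus\<close> kills
    it and \<open>Mgen\<close> multiplies it by 2.\<close>
  let ?a = "\<lambda>X. if X = Bplus then ?e else 0"
  \<comment> \<open>Used with \<open>r\<close> equal to 0, 2 and -2, where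
    \<open>(r - 2) / 2\<close> is -1, 0 and -2: only 2 is an eigenvalue, attained at
    \<open>n = 0\<close>.\<close>
  have ne: "complex_of_real (2 * real n + 2) \<noteq> complex_of_real r" if "real n \<noteq> (r - 2) / 2" for n r
    using that unfolding of_real_eq_iff by auto
  show "bij (plus_ops 2 Mgen)"
    unfolding plus_ops.simps by (rule bij_wshift_diagonal) (use ne[of _ 0] in simp)
  show "lie_cocycle fs_scale (plus_ops 2) ?a"
    by (simp add: lie_cocycle_def wshift_single fs_scale_single fs_minus_scale single_uminus[symmetric]
        del: single_one single_numeral)
       (auto intro!: poly_mapping_eqI)
  show "?a Bplus \<noteq> 0" by simp
  fix a assume a: "lie_cocycle fs_scale (plus_ops 2) a" "a Mgen = 0"
  then have "plus_ops 2 Mgen (a Bplus) = fs_scale 2 (a Bplus)"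
    and "plus_ops 2 Mgen (a Bminus) = fs_scale (- 2) (a Bminus)"
    by (auto simp: lie_cocycle_def fs_minus_scale)
  note eigen = this[unfolded plus_ops.simps]
  have "a Bplus = fs_scale (Poly_Mapping.lookup (a Bplus) 0) ?e"
    by (rule wshift_diagonal_eigenvector[OF eigen(1)]) (use ne[of _ "2"] in simp)
  moreover have "a Bminus = 0"
    by (rule wshift_diagonal_no_eigenvector[OF eigen(2)]) (use ne[of _ "- 2"] in simp)
  ultimately have "a X = fs_scale (Poly_Mapping.lookup (a Bplus) 0) (?a X)" for X
    using a(2) by (cases X) (auto intro!: poly_mapping_eqI)
  then show "\<exists>c. \<forall>X. a X = fs_scale c (?a X)" by blast
qed simp_all

lemma H1_has_dim_1_minus: "H1_has_dim fs_scale (rho_minus 2) 1"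
  unfolding rho_minus_def
proof (rule sl2_operators.H1_has_dim_1[OF sl2_operators_minus])
  let ?e = "Poly_Mapping.single 0 1 :: nat \<Rightarrow>\<^sub>0 complex"
  \<comment> \<open>The roles of \<open>Bplus\<close> and \<open>Bminus\<close> are exchanged, as
    \<open>e 0\<close> is now a highest weight vector of weight -2.\<close>
  let ?a = "\<lambda>X. if X = Bminus then ?e else 0"
  have ne: "complex_of_real (- (2 * real n + 2)) \<noteq> complex_of_real r" if "real n \<noteq> (- r - 2) / 2" for n r
    using that unfolding of_real_eq_iff by auto
  show "bij (minus_ops 2 Mgen)"
    unfolding minus_ops.simps by (rule bij_wshift_diagonal) (use ne[of _ 0] in simp)
  show "lie_cocycle fs_scale (minus_ops 2) ?a"
    by (simp add: lie_cocycle_def wshift_single fs_scale_single fs_minus_scale single_uminus[symmetric]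
        del: single_one single_numeral)
       (auto intro!: poly_mapping_eqI)
  show "?a Bminus \<noteq> 0" by simp
  fix a assume a: "lie_cocycle fs_scale (minus_ops 2) a" "a Mgen = 0"
  then have "minus_ops 2 Mgen (a Bminus) = fs_scale (- 2) (a Bminus)"
    and "minus_ops 2 Mgen (a Bplus) = fs_scale 2 (a Bplus)"
    by (auto simp: lie_cocycle_def fs_minus_scale)
  note eigen = this[unfolded minus_ops.simps]
  have "a Bminus = fs_scale (Poly_Mapping.lookup (a Bminus) 0) ?e"
    by (rule wshift_diagonal_eigenvector[OF eigen(1)]) (use ne[of _ "- 2"] in simp)
  moreover have "a Bplus = 0"
    by (rule wshift_diagonal_no_eigenvector[OF eigen(2)]) (use ne[of _ "2"] in simp)
  ultimately have "a X = fs_scale (Poly_Mapping.lookup (a Bminus) 0) (?a X)" for X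
    using a(2) by (cases X) (auto intro!: poly_mapping_eqI)
  then show "\<exists>c. \<forall>X. a X = fs_scale c (?a X)" by blast
qed simp_all

theorem proposition4p3p4:
  shows "H1_has_dim fs_scale (rho_plus 2) 1 \<and>
    H1_has_dim fs_scale (rho_minus 2) 1 \<and>
    (\<forall>(scale :: complex \<Rightarrow> 'd::ab_group_add \<Rightarrow> 'd) ip \<rho>.
       integrable_unitary_irrep scale ip \<rho> \<and>
       \<not> unitarily_equivalent scale ip \<rho> fs_scale fs_ip (rho_plus 2) \<and>
       \<not> unitarily_equivalent scale ip \<rho> fs_scale fs_ip (rho_minus 2) \<longrightarrow>
       H1_has_dim scale \<rho> 0)"
proof (intro conjI allI impI H1_has_dim_1_plus H1_has_dim_1_minus, elim conjE)
  fix scale :: "complex \<Rightarrow> 'd \<Rightarrow> 'd" and ip \<rho>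
  assume irrep: "integrable_unitary_irrep scale ip \<rho>"
    and not_plus: "\<not> unitarily_equivalent scale ip \<rho> fs_scale fs_ip (rho_plus 2)"
    and not_minus: "\<not> unitarily_equivalent scale ip \<rho> fs_scale fs_ip (rho_minus 2)"
  interpret U0_star_representation scale ip \<rho>
    using irrep by (simp add: integrable_unitary_irrep_def)
  note transfer = unitarily_equivalent_Z1_subset_B1[of scale ip \<rho>]
  \<comment> \<open>The two inequivalence assumptions exclude \<open>m\<^sub>0 = 2\<close> from the
    one-sided families.\<close>
  have "Z1 scale \<rho> \<subseteq> B1 \<rho>"
    using irrep not_plus not_minus unfolding integrable_unitary_irrep_def
    by (metis transfer Z1_subset_B1_trivial Z1_subset_B1_plus Z1_subset_B1_minus
        Z1_subset_B1_bilateral)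
  then show "H1_has_dim scale \<rho> 0" by (rule H1_has_dim_0)
qed

end
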